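(* Let $\varepsilon>0$, $d>0$ and $u_0\oplus v_0\in U\oplus U$. Let $u\oplus v$ be the mild solution on $X_\infty$ (with $\boldsymbol L_\bullet=\boldsymbol L$) with initial datum $u_0\oplus v_0$, defined on its maximal interval of existence $[0,\tau_{\max})$, and let $0<\tau<\tau_{\max}$. For $M\ge N$ let $u^{(M)}\oplus v^{(M)}$ be the mild solution on $X_M$ (with $\boldsymbol L_\bullet=\boldsymbol L_M$ and nonlinearity $f(u^{(M)},v^{(M)})$, $g(u^{(M)},v^{(M)})$, which lie in $X_M$) with initial datum $\boldsymbol P_Mu_0\oplus\boldsymbol P_Mv_0$. Then for all sufficiently large $M$, $u^{(M)}\oplus v^{(M)}$ exists on $[0,\tau]$, and $$\lim_{M\to\infty}\sup_{0\le t\le\tau}\|u^{(M)}(t)\oplus v^{(M)}(t)-u(t)\oplus v(t)\|=0.$$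
   Context: Let $p$ be a prime and $N\ge1$. Let $G_N^0$ be a nonempty finite set of $p$-adic integers $I=I_0+\dots+I_{N-1}p^{N-1}$ (digits in $\{0,\dots,p-1\}$), the vertex set of a graph with adjacency matrix $[A_{JI}]$, $A_{JI}\in\{0,1\}$. $\Omega(p^{r}|x-a|_p)$ is the characteristic function of $\{x:|x-a|_p\le p^{-r}\}$; $dx$ is Haar measure on $\mathbb Q_p$ with $\int_{\mathbb Z_p}dx=1$. $\mathcal K_N=\bigsqcup_I(I+p^N\mathbb Z_p)$, $J_N(x,y)=p^N\sum_{J,K}A_{JK}\Omega(p^N|x-J|_p)\Omega(p^N|y-K|_p)$, $X_\infty=C(\mathcal K_N,\mathbb R)$ with sup norm, $\boldsymbol L\varphi(x)=\int_{\mathcal K_N}(\varphi(y)-\varphi(x))J_N(x,y)dy$. For $M\ge N$ and $I\in G_N^0$, $G_I^M$ is a fixed set of representatives of the cosets of $p^M\mathbb Z_p$ in $I+p^N\mathbb Z_p$, $G_N^M=\bigsqcup_IG_I^M$, $X_M\subset X_\infty$ is the real span of $\{\Omega(p^M|x-R|_p)\}_{R\in G_N^M}$, $\boldsymbol L_M=\boldsymbol L|_{X_M}$, and $\boldsymbol P_M\varphi(x)=\sum_{R\in G_N^M}\varphi(R)\Omega(p^M|x-R|_p)$. Hypothesis 1: real $a<b$, $f,g\in C^1((a,b)^2)$ real-valued with $\nabla f\neq0$, $\nabla g\neq0$ on $(a,b)^2$. $U=\{w\in X_\infty:a<w(x)<b\ \forall x\}$; $f(u,v)$ means $x\mapsto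 f(u(x),v(x))$. Norm on $X_\bullet\oplus X_\bullet$: $\|u\oplus v\|=\max(\|u\|_\infty,\|v\|_\infty)$. For $X_\bullet\in\{X_\infty,X_M\}$ with operator $\boldsymbol L_\bullet\in\{\boldsymbol L,\boldsymbol L_M\}$, a mild solution on $[0,\tau_0)$ is $u\oplus v\in C([0,\tau_0),(U\cap X_\bullet)\oplus(U\cap X_\bullet))$ with $u(t)=e^{\varepsilon t\boldsymbol L_\bullet}u(0)+\int_0^te^{\varepsilon(t-s)\boldsymbol L_\bullet}f(u(s),v(s))ds$ and $v(t)=e^{\varepsilon dt\boldsymbol L_\bullet}v(0)+\int_0^te^{\varepsilon d(t-s)\boldsymbol L_\bullet}g(u(s),v(s))ds$. Mild solutions are unique; the maximal interval of existence $[0,\tau_{\max})$ is the union of all intervals $[0,\tau_0)$ on which a mild solution with the given initial datum exists. *)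

theory Defs
  imports "HOL-Probability.Probability"
begin

text \<open>p-adic integers are represented by their digit sequences x :: nat => nat with x i < p
  (x = x 0 + x 1 p + x 2 p^2 + ...).  The topology is the product topology on nat => nat
  (nat discrete), which is the p-adic topology on Z_p.\<close>

definition Zp :: "nat \<Rightarrow> (nat \<Rightarrow> nat) set" where
  "Zp p = {x. \<forall>i. x i < p}"

text \<open>Omega r a x = characteristic function of {x : |x - a|_p \<le> p^(-r)} (for x, a in Z_p):
  the first r digits agree.\<close>
definition Omega :: "nat \<Rightarrow> (nat \<Rightarrow> nat) \<Rightarrow> (nat \<Rightarrow> nat) \<Rightarrow> real" where
  "Omega r a x = (if \<forall>i<r. x i = a i then 1 else 0)"

definition KN :: "nat \<Rightarrow> nat \<Rightarrow> (nat \<Rightarrow> nat) set \<Rightarrow> (nat \<Rightarrow> nat) set" where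
  "KN p N G0 = {x \<in> Zp p. \<exists>I\<in>G0. \<forall>i<N. x i = I i}"

definition haar :: "nat \<Rightarrow> (nat \<Rightarrow> nat) measure" where
  "haar p = PiM UNIV (\<lambda>_. uniform_count_measure {0..<p})"

definition JN :: "nat \<Rightarrow> nat \<Rightarrow> (nat \<Rightarrow> nat) set \<Rightarrow> ((nat \<Rightarrow> nat) \<Rightarrow> (nat \<Rightarrow> nat) \<Rightarrow> real)
    \<Rightarrow> (nat \<Rightarrow> nat) \<Rightarrow> (nat \<Rightarrow> nat) \<Rightarrow> real" where
  "JN p N G0 A x y = real p ^ N * (\<Sum>J\<in>G0. \<Sum>K\<in>G0. A J K * Omega N J x * Omega N K y)"

definition Lop :: "nat \<Rightarrow> nat \<Rightarrow> (nat \<Rightarrow> nat) set \<Rightarrow> ((nat \<Rightarrow> nat) \<Rightarrow> (nat \<Rightarrow> nat) \<Rightarrow> real)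
    \<Rightarrow> ((nat \<Rightarrow> nat) \<Rightarrow> real) \<Rightarrow> (nat \<Rightarrow> nat) \<Rightarrow> real" where
  "Lop p N G0 A \<phi> x = (LINT y : KN p N G0 | haar p. (\<phi> y - \<phi> x) * JN p N G0 A x y)"

text \<open>The exponential e^{tL} of the bounded operator L, as its (norm-convergent) power series,
  evaluated pointwise.\<close>
definition expL :: "nat \<Rightarrow> nat \<Rightarrow> (nat \<Rightarrow> nat) set \<Rightarrow> ((nat \<Rightarrow> nat) \<Rightarrow> (nat \<Rightarrow> nat) \<Rightarrow> real)
    \<Rightarrow> real \<Rightarrow> ((nat \<Rightarrow> nat) \<Rightarrow> real) \<Rightarrow> (nat \<Rightarrow> nat) \<Rightarrow> real" where
  "expL p N G0 A t \<phi> x = (\<Sum>n. t ^ n / fact n * ((Lop p N G0 A ^^ n) \<phi>) x)"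

definition supdist :: "(nat \<Rightarrow> nat) set \<Rightarrow> ((nat \<Rightarrow> nat) \<Rightarrow> real) \<Rightarrow> ((nat \<Rightarrow> nat) \<Rightarrow> real) \<Rightarrow> real" where
  "supdist K \<phi> \<psi> = (SUP x\<in>K. \<bar>\<phi> x - \<psi> x\<bar>)"

definition inU :: "real \<Rightarrow> real \<Rightarrow> (nat \<Rightarrow> nat) set \<Rightarrow> ((nat \<Rightarrow> nat) \<Rightarrow> real) \<Rightarrow> bool" where
  "inU a b K \<phi> = (\<forall>x\<in>K. a < \<phi> x \<and> \<phi> x < b)"

definition XM :: "nat \<Rightarrow> nat \<Rightarrow> (nat \<Rightarrow> nat) set \<Rightarrow> (nat \<Rightarrow> nat) set \<Rightarrow> nat \<Rightarrow> ((nat \<Rightarrow> nat) \<Rightarrow> real) \<Rightarrow> bool" where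
  "XM p N G0 GMM M \<phi> = (\<exists>c. \<forall>x\<in>KN p N G0. \<phi> x = (\<Sum>R\<in>GMM. c R * Omega M R x))"

definition PM :: "(nat \<Rightarrow> nat) set \<Rightarrow> nat \<Rightarrow> ((nat \<Rightarrow> nat) \<Rightarrow> real) \<Rightarrow> (nat \<Rightarrow> nat) \<Rightarrow> real" where
  "PM GMM M \<phi> x = (\<Sum>R\<in>GMM. \<phi> R * Omega M R x)"

text \<open>Mild solution on [0,T) (T an extended real) in the space described by predicate XS.
  Continuity is w.r.t. the sup norm on K_N; the Bochner integral in X is written pointwise.\<close>
definition mild :: "nat \<Rightarrow> nat \<Rightarrow> (nat \<Rightarrow> nat) set \<Rightarrow> ((nat \<Rightarrow> nat) \<Rightarrow> (nat \<Rightarrow> nat) \<Rightarrow> real)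
    \<Rightarrow> real \<Rightarrow> real \<Rightarrow> (real \<Rightarrow> real \<Rightarrow> real) \<Rightarrow> (real \<Rightarrow> real \<Rightarrow> real) \<Rightarrow> real \<Rightarrow> real
    \<Rightarrow> (((nat \<Rightarrow> nat) \<Rightarrow> real) \<Rightarrow> bool) \<Rightarrow> ereal
    \<Rightarrow> ((nat \<Rightarrow> nat) \<Rightarrow> real) \<Rightarrow> ((nat \<Rightarrow> nat) \<Rightarrow> real)
    \<Rightarrow> (real \<Rightarrow> (nat \<Rightarrow> nat) \<Rightarrow> real) \<Rightarrow> (real \<Rightarrow> (nat \<Rightarrow> nat) \<Rightarrow> real) \<Rightarrow> bool" where
  "mild p N G0 A a b f g \<epsilon> d XS T u0 v0 u v \<longleftrightarrow>
     (let K = KN p N G0; I = {t. 0 \<le> t \<and> ereal t < T} in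
      (\<forall>t\<in>I. XS (u t) \<and> XS (v t) \<and> inU a b K (u t) \<and> inU a b K (v t)) \<and>
      (\<forall>t\<in>I. \<forall>e>0. \<exists>\<delta>>0. \<forall>s\<in>I. \<bar>s - t\<bar> < \<delta> \<longrightarrow>
          supdist K (u s) (u t) < e \<and> supdist K (v s) (v t) < e) \<and>
      (\<forall>t\<in>I. \<forall>x\<in>K.
          u t x = expL p N G0 A (\<epsilon> * t) u0 x
            + integral {0..t} (\<lambda>s. expL p N G0 A (\<epsilon> * (t - s)) (\<lambda>y. f (u s y) (v s y)) x) \<and>
          v t x = expL p N G0 A (\<epsilon> * d * t) v0 x
            + integral {0..t} (\<lambda>s. expL p N G0 A (\<epsilon> * d * (t - s)) (\<lambda>y. g (u s y) (v s y)) x)))"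

definition tmax :: "nat \<Rightarrow> nat \<Rightarrow> (nat \<Rightarrow> nat) set \<Rightarrow> ((nat \<Rightarrow> nat) \<Rightarrow> (nat \<Rightarrow> nat) \<Rightarrow> real)
    \<Rightarrow> real \<Rightarrow> real \<Rightarrow> (real \<Rightarrow> real \<Rightarrow> real) \<Rightarrow> (real \<Rightarrow> real \<Rightarrow> real) \<Rightarrow> real \<Rightarrow> real
    \<Rightarrow> (((nat \<Rightarrow> nat) \<Rightarrow> real) \<Rightarrow> bool)
    \<Rightarrow> ((nat \<Rightarrow> nat) \<Rightarrow> real) \<Rightarrow> ((nat \<Rightarrow> nat) \<Rightarrow> real) \<Rightarrow> ereal" where
  "tmax p N G0 A a b f g \<epsilon> d XS u0 v0 =
     Sup {T. \<exists>u v. mild p N G0 A a b f g \<epsilon> d XS T u0 v0 u v}"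

definition C1_grad :: "real \<Rightarrow> real \<Rightarrow> (real \<Rightarrow> real \<Rightarrow> real) \<Rightarrow> bool" where
  "C1_grad a b f \<longleftrightarrow> (\<exists>Df :: real \<times> real \<Rightarrow> real \<times> real.
     continuous_on ({a<..<b} \<times> {a<..<b}) Df \<and>
     (\<forall>z\<in>{a<..<b} \<times> {a<..<b}.
        ((\<lambda>w. f (fst w) (snd w)) has_derivative (\<lambda>h. Df z \<bullet> h)) (at z) \<and> Df z \<noteq> 0))"

end

(*
  The space X_M is invariant under L and under superposition with f and g, so u^(M), v^(M) solve the
  same mild equation as u, v and only the initial data differ: P_M u0, P_M v0 instead of u0, v0.
  The theorem is therefore continuous dependence on the initial data, plus existence up to time tau.
  To get both, f and g are replaced by f, g composed with the projection onto a box inside (a,b)^2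
  that contains a neighbourhood of the (compact) range of the given solution on [0,T], tau < T < tau_max.
  The truncated equation is globally Lipschitz, hence solvable on [0,T] by a contraction in a weighted
  sup norm, within X_M; since P_M u0 tends to u0 uniformly, for large M these solutions stay in the box,
  where the truncation has no effect.
*)
theory Submission
  imports Defs
begin

text \<open>The obstacle is that \<open>mild\<close> is stated pointwise on K, for functions with
  arbitrary values elsewhere, while the fixed-point argument lives in a Banach space. A continuous
  retraction embeds C(K) into the bounded continuous functions on all digit sequences, and
  evaluation at a point, a bounded linear functional, passes through the exponential series and the
  Duhamel integral; this translates the pointwise equation into the abstract one and back. X_M
  becomes the space of functions of the first M digits, a common kernel of differences of
  evaluations, hence a closed subspace that integrals cannot leave. It is invariant under L because
  the kernel of L sees only the first N <= M digits.\<close>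

section \<open>Mild equations with Lipschitz nonlinearity\<close>

text \<open>The library proves completeness of spaces of bounded continuous functions for metric
  domains only; with a metric on \<open>nat\<close> the digit sequences \<open>nat \<Rightarrow> nat\<close> become such a domain.\<close>

instantiation nat :: metric_space
begin

definition dist_nat :: "nat \<Rightarrow> nat \<Rightarrow> real" where
  "dist_nat m n = \<bar>real m - real n\<bar>"

definition uniformity_nat :: "(nat \<times> nat) filter" where
  "uniformity_nat = (INF e\<in>{0<..}. principal {(x, y). dist x y < e})"

instance
proof
  fix U :: "nat set"
  have "y \<in> U" if "x \<in> U" "dist x y < 1" for x y
  proof -
    have "x = y"
      using that(2) unfolding dist_nat_def by linarith
    with that(1) show ?thesis by simp
  qed
  then have "\<forall>\<^sub>F (x', y) in uniformity. x' = x \<longrightarrow> y \<in> U" if "x \<in> U" for x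
    unfolding uniformity_nat_def
    by (intro eventually_INF1[of 1]) (use that in \<open>auto simp: eventually_principal\<close>)
  then show "open U \<longleftrightarrow> (\<forall>x\<in>U. \<forall>\<^sub>F (x', y) in uniformity. x' = x \<longrightarrow> y \<in> U)"
    by (simp add: Topological_Spaces.open_discrete)
qed (auto simp: dist_nat_def uniformity_nat_def)

end

instance bcontfun :: (metric_space, banach) banach ..

lemma has_integral_exp_mult:
  fixes l t :: real
  assumes "l > 0" "0 \<le> t"
  shows "((\<lambda>s. exp (l * s)) has_integral (exp (l * t) - 1) / l) {0..t}"
proof -
  have "((\<lambda>s. exp (l * s)) has_integral exp (l * t) / l - exp (l * 0) / l) {0..t}"
    using assms
    by (intro fundamental_theorem_of_calculus)
       (auto intro!: derivative_eq_intros simp flip: has_real_derivative_iff_has_vector_derivative)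
  then show ?thesis
    by (simp add: diff_divide_distrib)
qed

text \<open>Used with \<open>S t\<close> the diagonal pair of exp(\<epsilon> t L) and exp(\<epsilon>
  d t L), and \<open>F\<close> the truncated nonlinearity on pairs. Continuity of \<open>S\<close>
  is assumed only for each fixed w.\<close>

locale mild_equation =
  fixes S :: "real \<Rightarrow> 'e::banach \<Rightarrow> 'e" and F :: "'e \<Rightarrow> 'e" and T C \<Lambda> :: real
  assumes T_nonneg: "0 \<le> T" and C_nonneg: "0 \<le> C"
    and linear_S: "t \<in> {0..T} \<Longrightarrow> bounded_linear (S t)"
    and norm_S: "t \<in> {0..T} \<Longrightarrow> norm (S t w) \<le> C * norm w"
    and continuous_S: "continuous_on {0..T} (\<lambda>t. S t w)"
    and lipschitz_F: "\<Lambda>-lipschitz_on UNIV F"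
begin

definition duhamel :: "(real \<Rightarrow> 'e) \<Rightarrow> real \<Rightarrow> 'e" where
  "duhamel h t = integral {0..t} (\<lambda>s. S (t - s) (h s))"

definition solves :: "'e \<Rightarrow> (real \<Rightarrow> 'e) \<Rightarrow> bool" where
  "solves w0 w \<longleftrightarrow> continuous_on {0..T} w \<and>
     (\<forall>t\<in>{0..T}. w t = S t w0 + duhamel (\<lambda>s. F (w s)) t)"

text \<open>The factor is chosen so that \<open>C * \<Lambda> / growth \<le> 1/2\<close>: measured in the norm
  \<open>SUP t. exp (- growth * t) * norm (w t)\<close> the Duhamel term is a contraction on all of \<open>[0,T]\<close>.\<close>
definition growth :: real where
  "growth = 2 * C * \<Lambda> + 1"

lemma Lam_nonneg: "0 \<le> \<Lambda>"
  using lipschitz_F by (rule lipschitz_on_nonneg)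

lemma norm_F_diff: "norm (F w - F w') \<le> \<Lambda> * norm (w - w')"
  using lipschitz_onD[OF lipschitz_F, of w w'] by (simp add: dist_norm)

lemma continuous_F: "continuous_on A h \<Longrightarrow> continuous_on A (\<lambda>z. F (h z))"
  using continuous_on_compose2[OF lipschitz_on_continuous_on[OF lipschitz_F]] by blast

lemma growth_pos: "growth > 0"
  using C_nonneg Lam_nonneg by (simp add: growth_def add_nonneg_pos)

lemma contraction_factor: "C * \<Lambda> / growth \<le> 1 / 2"
  using growth_pos by (simp add: growth_def field_simps)

text \<open>\<open>S\<close> is only strongly continuous, so h y is compared with the fixed h z: S(r
  y)(h y) = S(r y)(h y - h z) + S(r y)(h z). The first term tends to 0 by the uniform bound
  \<open>C\<close>, the second converges by strong continuity.\<close>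

lemma continuous_S_compose:
  assumes "continuous_on D r" "r ` D \<subseteq> {0..T}" "continuous_on D h"
  shows "continuous_on D (\<lambda>z. S (r z) (h z))"
  unfolding continuous_on_def
proof
  fix z assume z: "z \<in> D"
  have r: "r y \<in> {0..T}" if "y \<in> D" for y
    using assms(2) that by auto
  have "continuous_on D (\<lambda>y. S (r y) (h z))"
    using continuous_on_compose2[OF continuous_S assms(1,2)] .
  then have 1: "((\<lambda>y. S (r y) (h z)) \<longlongrightarrow> S (r z) (h z)) (at z within D)"
    using z by (simp add: continuous_on_def)
  have hz: "(h \<longlongrightarrow> h z) (at z within D)"
    using assms(3) z by (simp add: continuous_on_def)
  have "((\<lambda>y. S (r y) (h y - h z)) \<longlongrightarrow> 0) (at z within D)"
  proof (rule Lim_null_comparison)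
    show "\<forall>\<^sub>F y in at z within D. norm (S (r y) (h y - h z)) \<le> C * norm (h y - h z)"
      using r norm_S by (auto simp: eventually_at_filter)
    show "((\<lambda>y. C * norm (h y - h z)) \<longlongrightarrow> 0) (at z within D)"
      using tendsto_mult[OF tendsto_const tendsto_norm[OF tendsto_diff[OF hz tendsto_const]],
          of C "h z"] by simp
  qed
  from tendsto_add[OF this 1]
  have "((\<lambda>y. S (r y) (h y - h z) + S (r y) (h z)) \<longlongrightarrow> S (r z) (h z)) (at z within D)"
    by simp
  moreover have "\<forall>\<^sub>F y in at z within D. S (r y) (h y - h z) + S (r y) (h z) = S (r y) (h y)"
    using r by (auto simp: eventually_at_filter linear_diff[OF bounded_linear.linear[OF linear_S]])
  ultimately show "((\<lambda>y. S (r y) (h y)) \<longlongrightarrow> S (r z) (h z)) (at z within D)"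
    by (rule Lim_transform_eventually)
qed

lemma continuous_integrand:
  assumes "continuous_on {0..T} h" "t \<in> {0..T}"
  shows "continuous_on {0..t} (\<lambda>s. S (t - s) (h s))"
  using assms
  by (intro continuous_S_compose continuous_intros continuous_on_subset[OF assms(1)]) auto

text \<open>The substitution s = t r moves t from the domain of integration into the integrand, so
  that continuity in t becomes continuity of a parameter integral over the fixed interval
  [0,1].\<close>

lemma duhamel_rescaled:
  assumes "t \<in> {0..T}"
  shows "duhamel h t = t *\<^sub>R integral {0..1} (\<lambda>r. S (t * (1 - r)) (h (t * r)))"
proof (cases "t = 0")
  case True
  then show ?thesis by (simp add: duhamel_def)
next
  case False
  with assms have t: "t > 0" by auto
  have img: "(\<lambda>x. x / t) ` {0..t} = {0..1}"
  proof (intro equalityI subsetI)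
    fix x assume "x \<in> {0..1::real}"
    then show "x \<in> (\<lambda>x. x / t) ` {0..t}"
      using t by (intro image_eqI[of _ _ "t * x"]) (auto simp: mult_le_cancel_left1)
  qed (use t in auto)
  have "integral {0..1} (\<lambda>r. S (t - t * r) (h (t * r))) = (1 / \<bar>t\<bar>) *\<^sub>R duhamel h t"
    using integral_stretch_real[OF False, of 0 t "\<lambda>s. S (t - s) (h s)"]
    by (simp add: img duhamel_def)
  then show ?thesis
    using t by (simp add: right_diff_distrib)
qed

lemma continuous_duhamel:
  assumes "continuous_on {0..T} h"
  shows "continuous_on {0..T} (duhamel h)"
proof -
  have sub: "t * r \<in> {0..T}" if "t \<in> {0..T}" "r \<in> {0..1}" for t r
    using mult_mono[of t T r 1] that by auto
  have "continuous_on ({0..T} \<times> {0..1}) (\<lambda>z. S (fst z * (1 - snd z)) (h (fst z * snd z)))"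
  proof (rule continuous_S_compose)
    show "(\<lambda>z. fst z * (1 - snd z)) ` ({0..T} \<times> {0..1}) \<subseteq> {0..T}"
    proof safe
      fix t r assume "t \<in> {0..T}" "r \<in> {0..1::real}"
      then show "fst (t, r) * (1 - snd (t, r)) \<in> {0..T}"
        using sub[of t "1 - r"] by simp
    qed
    show "continuous_on ({0..T} \<times> {0..1}) (\<lambda>z. h (fst z * snd z))"
      by (rule continuous_on_compose2[OF assms]) (auto intro!: continuous_intros sub simp del: atLeastAtMost_iff)
  qed (intro continuous_intros)
  then have "continuous_on {0..T} (\<lambda>t. integral (cbox 0 1) (\<lambda>r. S (t * (1 - r)) (h (t * r))))"
    by (intro integral_continuous_on_param) (simp add: case_prod_unfold)
  then have "continuous_on {0..T}
      (\<lambda>t. t *\<^sub>R integral {0..1} (\<lambda>r. S (t * (1 - r)) (h (t * r))))"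
    by (intro continuous_intros) simp
  then show ?thesis
    by (rule continuous_on_eq) (simp add: duhamel_rescaled)
qed

lemma duhamel_diff:
  assumes "continuous_on {0..T} h" "continuous_on {0..T} h'" "t \<in> {0..T}"
  shows "duhamel h t - duhamel h' t = duhamel (\<lambda>s. h s - h' s) t"
proof -
  have "duhamel (\<lambda>s. h s - h' s) t = integral {0..t} (\<lambda>s. S (t - s) (h s) - S (t - s) (h' s))"
    unfolding duhamel_def using assms(3)
    by (intro integral_cong linear_diff bounded_linear.linear linear_S) auto
  also have "\<dots> = duhamel h t - duhamel h' t"
    unfolding duhamel_def using assms
    by (intro integral_diff integrable_continuous_interval continuous_integrand)
  finally show ?thesis ..
qed

text \<open>Integrating exp(growth s) over [0,t] produces the factor 1/growth: a steep weight makes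
  the Duhamel term small relative to the data.\<close>

lemma norm_duhamel_le:
  assumes "continuous_on {0..T} h" "t \<in> {0..T}"
    and "\<And>s. s \<in> {0..t} \<Longrightarrow> norm (h s) \<le> D * exp (growth * s)"
  shows "norm (duhamel h t) \<le> C * D / growth * exp (growth * t)"
proof -
  have D: "0 \<le> D"
    using assms(2) order_trans[OF norm_ge_zero assms(3)[of 0]] by auto
  have hi: "((\<lambda>s. C * D * exp (growth * s)) has_integral C * D * ((exp (growth * t) - 1) / growth)) {0..t}"
    using assms(2) by (intro has_integral_mult_right has_integral_exp_mult growth_pos) auto
  have "norm (duhamel h t) \<le> integral {0..t} (\<lambda>s. C * D * exp (growth * s))"
    unfolding duhamel_def
  proof (rule integral_norm_bound_integral)
    fix s assume s: "s \<in> {0..t}"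
    have "norm (S (t - s) (h s)) \<le> C * norm (h s)"
      using s assms(2) by (intro norm_S) auto
    also have "\<dots> \<le> C * (D * exp (growth * s))"
      using C_nonneg assms(3)[OF s] by (rule mult_left_mono[rotated])
    finally show "norm (S (t - s) (h s)) \<le> C * D * exp (growth * s)"
      by (simp add: mult.assoc)
  qed (use hi assms in \<open>auto intro: integrable_continuous_interval continuous_integrand
        simp: has_integral_integrable simp del: atLeastAtMost_iff\<close>)
  also have "\<dots> = C * D / growth * (exp (growth * t) - 1)"
    unfolding integral_unique[OF hi] by simp
  also have "\<dots> \<le> C * D / growth * exp (growth * t)"
    using C_nonneg D growth_pos by (intro mult_left_mono) auto
  finally show ?thesis .
qed

lemma norm_duhamel_F_diff_le:
  assumes "continuous_on {0..T} w" "continuous_on {0..T} w'" "t \<in> {0..T}" "0 \<le> D"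
    and "\<And>s. s \<in> {0..t} \<Longrightarrow> norm (w s - w' s) \<le> D * exp (growth * s)"
  shows "norm (duhamel (\<lambda>s. F (w s)) t - duhamel (\<lambda>s. F (w' s)) t) \<le> D / 2 * exp (growth * t)"
proof -
  have "norm (duhamel (\<lambda>s. F (w s)) t - duhamel (\<lambda>s. F (w' s)) t)
      = norm (duhamel (\<lambda>s. F (w s) - F (w' s)) t)"
    using assms by (simp add: duhamel_diff continuous_F)
  also have "\<dots> \<le> C * (\<Lambda> * D) / growth * exp (growth * t)"
  proof (rule norm_duhamel_le)
    fix s assume "s \<in> {0..t}"
    then show "norm (F (w s) - F (w' s)) \<le> \<Lambda> * D * exp (growth * s)"
      using order_trans[OF norm_F_diff mult_left_mono[OF assms(5) Lam_nonneg]]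
      by (simp add: mult.assoc)
  qed (use assms in \<open>auto intro!: continuous_intros continuous_F\<close>)
  also have "C * (\<Lambda> * D) / growth = D * (C * \<Lambda> / growth)"
    by simp
  also have "D * (C * \<Lambda> / growth) * exp (growth * t) \<le> D * (1 / 2) * exp (growth * t)"
    by (intro mult_right_mono mult_left_mono contraction_factor assms(4)) auto
  finally show ?thesis by simp
qed

text \<open>In place of Gronwall: the weighted distance attains its maximum \<open>D\<close> at some
  \<open>t1\<close>, where the equation gives D <= C |w0 - w0'| + D/2. Absorbing D/2 yields the
  factor 2; removing the weight costs exp(growth T).\<close>

lemma solves_dependence:
  assumes "solves w0 w" "solves w0' w'" "t \<in> {0..T}"
  shows "norm (w t - w' t) \<le> 2 * C * exp (growth * T) * norm (w0 - w0')"
proof -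
  let ?q = "\<lambda>t. exp (- growth * t) * norm (w t - w' t)"
  have cont: "continuous_on {0..T} w" "continuous_on {0..T} w'"
    using assms(1,2) by (auto simp: solves_def)
  have "continuous_on {0..T} ?q"
    using cont by (intro continuous_intros)
  then obtain t1 where t1: "t1 \<in> {0..T}" and max: "\<And>s. s \<in> {0..T} \<Longrightarrow> ?q s \<le> ?q t1"
    using continuous_attains_sup[of "{0..T}" ?q] T_nonneg by auto
  define D where "D = ?q t1"
  have D: "norm (w s - w' s) \<le> D * exp (growth * s)" if "s \<in> {0..T}" for s
    using max[OF that] by (simp add: D_def exp_minus field_simps)
  have D_nonneg: "0 \<le> D"
    by (simp add: D_def)
  have "w t1 - w' t1 = S t1 (w0 - w0') + (duhamel (\<lambda>s. F (w s)) t1 - duhamel (\<lambda>s. F (w' s)) t1)"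
    using assms(1,2) t1 by (simp add: solves_def linear_diff[OF bounded_linear.linear[OF linear_S]])
  then have "norm (w t1 - w' t1) \<le> norm (S t1 (w0 - w0'))
      + norm (duhamel (\<lambda>s. F (w s)) t1 - duhamel (\<lambda>s. F (w' s)) t1)"
    by (simp add: norm_triangle_ineq)
  also have "\<dots> \<le> C * norm (w0 - w0') + D / 2 * exp (growth * t1)"
    using t1 by (intro add_mono norm_S norm_duhamel_F_diff_le cont D D_nonneg) auto
  finally have "D \<le> exp (- growth * t1) * (C * norm (w0 - w0') + D / 2 * exp (growth * t1))"
    unfolding D_def by (rule mult_left_mono) simp
  also have "\<dots> = exp (- growth * t1) * (C * norm (w0 - w0')) + D / 2"
    by (simp add: algebra_simps exp_minus)
  also have "exp (- growth * t1) * (C * norm (w0 - w0')) \<le> 1 * (C * norm (w0 - w0'))"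
    using t1 growth_pos C_nonneg by (intro mult_right_mono) auto
  finally have D_le: "D \<le> 2 * (C * norm (w0 - w0'))"
    by simp
  have "norm (w t - w' t) \<le> D * exp (growth * t)"
    by (rule D[OF assms(3)])
  also have "\<dots> \<le> 2 * (C * norm (w0 - w0')) * exp (growth * T)"
    using D_le D_nonneg assms(3) growth_pos C_nonneg by (intro mult_mono) auto
  finally show ?thesis by (simp add: mult_ac)
qed

text \<open>Banach's fixed point theorem for W = exp(-growth t) w, in which the ordinary sup metric
  is the weighted one. Describing \<open>V\<close> as a common kernel of functionals makes it a
  closed subspace and lets integrals with values in \<open>V\<close> be tested one functional at a
  time.\<close>

lemma solves_exists:
  assumes lin: "\<And>l. l \<in> Q \<Longrightarrow> bounded_linear (l :: 'e \<Rightarrow> real)"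
    and w0: "w0 \<in> V" and V: "V = {w. \<forall>l\<in>Q. l w = 0}"
    and S_V: "\<And>t w. t \<in> {0..T} \<Longrightarrow> w \<in> V \<Longrightarrow> S t w \<in> V"
    and F_V: "\<And>w. w \<in> V \<Longrightarrow> F w \<in> V"
  obtains w where "solves w0 w" "\<And>t. t \<in> {0..T} \<Longrightarrow> w t \<in> V"
proof -
  define unweight :: "(real \<Rightarrow>\<^sub>C 'e) \<Rightarrow> real \<Rightarrow> 'e" where
    "unweight W s = exp (growth * s) *\<^sub>R W s" for W s
  define \<Phi> where "\<Phi> W t = exp (- growth * t) *\<^sub>R (S t w0 + duhamel (\<lambda>s. F (unweight W s)) t)" for W t
  have cont_unweight: "continuous_on A (unweight W)" for A W
    unfolding unweight_def by (intro continuous_intros) simp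
  have cont: "continuous_on {0..T} (\<Phi> W)" for W
    unfolding \<Phi>_def
    by (intro continuous_intros continuous_S continuous_duhamel continuous_F cont_unweight)
  \<comment> \<open>Freezing time outside [0,T] turns a continuous function on the interval into a
    bounded continuous one on the line with the same range.\<close>
  have "\<exists>W'. \<forall>t. apply_bcontfun W' t = \<Phi> W (clamp 0 T t)" for W
    using continuous_on_cbox_bcontfunE[of 0 T "\<Phi> W"] cont by (metis interval_cbox)
  then obtain P where P: "\<And>W t. apply_bcontfun (P W) t = \<Phi> W (clamp 0 T t)"
    by metis
  have clamp: "clamp 0 T t \<in> {0..T}" for t
    using T_nonneg clamp_in_interval[of 0 T t] by auto
  define X :: "(real \<Rightarrow>\<^sub>C 'e) set" where "X = {W. \<forall>t. apply_bcontfun W t \<in> V}"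
  have scale_V: "c *\<^sub>R w \<in> V" if "w \<in> V" for c w
    using that lin by (auto simp: V linear_simps)
  have add_V: "w + w' \<in> V" if "w \<in> V" "w' \<in> V" for w w'
    using that lin by (auto simp: V linear_simps)
  have duhamel_V: "duhamel h t \<in> V"
    if h: "continuous_on {0..T} h" and h_V: "\<And>s. h s \<in> V" and t: "t \<in> {0..T}" for h t
  proof -
    have "l (duhamel h t) = 0" if l: "l \<in> Q" for l
    proof -
      have "l (duhamel h t) = integral {0..t} (l \<circ> (\<lambda>s. S (t - s) (h s)))"
        unfolding duhamel_def 
        by (intro integral_linear[symmetric] lin l integrable_continuous_interval continuous_integrand h t)
      also have "\<dots> = integral {0..t} (\<lambda>s. 0)"
      proof (rule integral_cong)
        fix s assume "s \<in> {0..t}"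
        then have "S (t - s) (h s) \<in> V"
          using t by (intro S_V h_V) auto
        then show "(l \<circ> (\<lambda>s. S (t - s) (h s))) s = 0"
          using l by (simp add: V)
      qed
      finally show ?thesis by simp
    qed
    then show ?thesis by (simp add: V)
  qed
  have closed_V: "closed V"
  proof -
    have "V = (\<Inter>l\<in>Q. l -` {0})"
      by (auto simp: V)
    moreover have "closed (l -` {0})" if "l \<in> Q" for l
      using linear_continuous_on[OF lin[OF that], of UNIV]
      by (intro closed_vimage) (auto simp: continuous_on_eq_continuous_at)
    ultimately show ?thesis by auto
  qed
  have "Topological_Spaces.complete X"
  proof -
    have "X = PiC UNIV (\<lambda>_. V)"
      by (auto simp: X_def mem_PiC_iff Pi_iff)
    then show ?thesis
      by (simp add: complete_eq_closed closed_PiC closed_V)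
  qed
  moreover have "X \<noteq> {}"
  proof -
    have "0 \<in> X"
      using scale_V[OF w0, of 0] by (simp add: X_def)
    then show ?thesis by blast
  qed
  moreover have "P ` X \<subseteq> X"
  proof safe
    fix W assume "W \<in> X"
    then have "unweight W s \<in> V" for s
      by (simp add: unweight_def X_def scale_V)
    then have "apply_bcontfun (P W) t \<in> V" for t
      unfolding P \<Phi>_def
      by (intro scale_V add_V S_V w0 duhamel_V F_V continuous_F cont_unweight clamp)
    then show "P W \<in> X"
      by (simp add: X_def)
  qed
  moreover have "dist (P W) (P W') \<le> 1 / 2 * dist W W'" for W W'
  proof (rule dist_bound)
    fix t
    let ?t = "clamp 0 T t"
    have "norm (duhamel (\<lambda>s. F (unweight W s)) ?t - duhamel (\<lambda>s. F (unweight W' s)) ?t)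
        \<le> dist W W' / 2 * exp (growth * ?t)"
    proof (rule norm_duhamel_F_diff_le)
      fix s
      have "norm (unweight W s - unweight W' s) = dist (W s) (W' s) * exp (growth * s)"
        unfolding unweight_def scaleR_diff_right[symmetric] by (simp add: dist_norm)
      then show "norm (unweight W s - unweight W' s) \<le> dist W W' * exp (growth * s)"
        by (simp add: dist_bounded)
    qed (use clamp cont_unweight in auto)
    then have "exp (- growth * ?t) * norm (duhamel (\<lambda>s. F (unweight W s)) ?t
          - duhamel (\<lambda>s. F (unweight W' s)) ?t) \<le> dist W W' / 2"
      by (simp add: exp_minus field_simps)
    moreover have "dist (P W t) (P W' t) = exp (- growth * ?t) *
        norm (duhamel (\<lambda>s. F (unweight W s)) ?t - duhamel (\<lambda>s. F (unweight W' s)) ?t)"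
      by (simp add: P \<Phi>_def dist_norm scaleR_diff_right[symmetric])
    ultimately show "dist (P W t) (P W' t) \<le> 1 / 2 * dist W W'"
      by simp
  qed
  ultimately obtain W where W: "W \<in> X" "P W = W"
    using Banach_fix[of X "1 / 2" P] by auto
  have eq: "unweight W t = S t w0 + duhamel (\<lambda>s. F (unweight W s)) t" if "t \<in> {0..T}" for t
  proof -
    have "clamp 0 T t = t"
      using that by (intro clamp_cancel_cbox) simp
    then have "apply_bcontfun W t = \<Phi> W t"
      using P[of W t] unfolding W(2) by simp
    then show ?thesis
      by (simp add: unweight_def[of W t] \<Phi>_def exp_minus)
  qed
  show ?thesis
  proof (rule that)
    show "solves w0 (unweight W)"
      using eq cont_unweight by (simp add: solves_def)
    show "unweight W t \<in> V" for t
      using W by (simp add: unweight_def X_def scale_V)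
  qed
qed

end

section \<open>The exponential series of a bounded operator\<close>

definition op_exp :: "('e::banach \<Rightarrow> 'e) \<Rightarrow> real \<Rightarrow> 'e \<Rightarrow> 'e" where
  "op_exp L t w = (\<Sum>n. (t ^ n / fact n) *\<^sub>R (L ^^ n) w)"

context
  fixes L :: "'e::banach \<Rightarrow> 'e" and B :: real
  assumes linear_L: "linear L" and norm_L: "\<And>w. norm (L w) \<le> B * norm w" and B_nonneg: "0 \<le> B"
begin

lemma norm_funpow_le: "norm ((L ^^ n) w) \<le> B ^ n * norm w"
proof (induction n)
  case (Suc n)
  have "norm (L ((L ^^ n) w)) \<le> B * norm ((L ^^ n) w)"
    by (rule norm_L)
  also have "\<dots> \<le> B * (B ^ n * norm w)"
    using Suc B_nonneg by (rule mult_left_mono)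
  finally show ?case by (simp add: mult.assoc)
qed simp

lemma linear_funpow: "linear (L ^^ n)"
proof (induction n)
  case (Suc n)
  show ?case
    unfolding funpow.simps by (rule linear_compose[OF Suc linear_L])
qed (simp add: linear_id[unfolded id_def] id_def)

text \<open>The radius \<open>R\<close> makes the majorant independent of t, as the Weierstrass
  M-test in \<open>continuous_op_exp\<close> requires; R = |t| gives the norm bound.\<close>

lemma norm_op_exp_term_le:
  assumes "\<bar>t\<bar> \<le> R"
  shows "norm ((t ^ n / fact n) *\<^sub>R (L ^^ n) w) \<le> (R * B) ^ n / fact n * norm w"
proof -
  have "norm ((t ^ n / fact n) *\<^sub>R (L ^^ n) w) = \<bar>t\<bar> ^ n / fact n * norm ((L ^^ n) w)"
    by (simp add: power_abs)
  also have "\<dots> \<le> R ^ n / fact n * (B ^ n * norm w)"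
    using assms by (intro mult_mono norm_funpow_le divide_right_mono power_mono) auto
  finally show ?thesis by (simp add: power_mult_distrib mult_ac)
qed

lemma sums_op_exp_majorant: "(\<lambda>n. (R * B) ^ n / fact n * c) sums (exp (R * B) * c)"
  using sums_mult2[OF exp_converges[of "R * B"], of c] by (simp add: divide_inverse mult_ac)

lemma summable_op_exp: "summable (\<lambda>n. (t ^ n / fact n) *\<^sub>R (L ^^ n) w)"
  by (rule summable_comparison_test'[OF sums_summable[OF sums_op_exp_majorant]])
     (rule norm_op_exp_term_le[OF order_refl])

lemma norm_op_exp_le: "norm (op_exp L t w) \<le> exp (\<bar>t\<bar> * B) * norm w"
proof -
  have sm: "summable (\<lambda>n. norm ((t ^ n / fact n) *\<^sub>R (L ^^ n) w))"
    by (rule summable_comparison_test'[OF sums_summable[OF sums_op_exp_majorant]])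
       (unfold real_norm_def abs_norm_cancel, rule norm_op_exp_term_le[OF order_refl])
  have "norm (op_exp L t w) \<le> (\<Sum>n. norm ((t ^ n / fact n) *\<^sub>R (L ^^ n) w))"
    unfolding op_exp_def by (rule summable_norm[OF sm])
  also have "\<dots> \<le> (\<Sum>n. (\<bar>t\<bar> * B) ^ n / fact n * norm w)"
    by (intro suminf_le norm_op_exp_term_le sm sums_summable[OF sums_op_exp_majorant]) simp
  finally show ?thesis
    using sums_unique[OF sums_op_exp_majorant] by simp
qed

lemma linear_op_exp: "linear (op_exp L t)"
proof (rule linearI)
  fix w w' :: 'e and c :: real
  show "op_exp L t (w + w') = op_exp L t w + op_exp L t w'"
    unfolding op_exp_def
    by (simp add: suminf_add summable_op_exp linear_add[OF linear_funpow] scaleR_add_right)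
  show "op_exp L t (c *\<^sub>R w) = c *\<^sub>R op_exp L t w"
    unfolding op_exp_def
    using suminf_scaleR_right[OF summable_op_exp, of c t w]
    by (simp add: linear_scale[OF linear_funpow] mult_ac)
qed

lemma bounded_linear_op_exp: "bounded_linear (op_exp L t)"
  using linear_op_exp norm_op_exp_le[of t]
  by (intro bounded_linear.intro bounded_linear_axioms.intro exI[of _ "exp (\<bar>t\<bar> * B)"])
     (auto simp: mult_ac)

lemma continuous_op_exp: "continuous_on {-R..R} (\<lambda>t. op_exp L t w)"
  unfolding op_exp_def
proof (rule uniform_limit_theorem)
  show "uniform_limit {-R..R} (\<lambda>n t. \<Sum>i<n. (t ^ i / fact i) *\<^sub>R (L ^^ i) w)
      (\<lambda>t. \<Sum>n. (t ^ n / fact n) *\<^sub>R (L ^^ n) w) sequentially"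
    by (rule Weierstrass_m_test[OF norm_op_exp_term_le[where R = R] sums_summable[OF sums_op_exp_majorant]]) auto
  show "\<forall>\<^sub>F n in sequentially. continuous_on {-R..R} (\<lambda>t. \<Sum>i<n. (t ^ i / fact i) *\<^sub>R (L ^^ i) w)"
    by (intro always_eventually allI continuous_intros) auto
qed simp

text \<open>With \<open>l\<close> evaluation at a point this recovers the pointwise series that
  defines \<open>expL\<close>.\<close>

lemma bounded_linear_op_exp_suminf:
  assumes "bounded_linear l"
  shows "l (op_exp L t w) = (\<Sum>n. (t ^ n / fact n) *\<^sub>R l ((L ^^ n) w))"
  unfolding op_exp_def bounded_linear.suminf[OF assms summable_op_exp]
  by (simp add: linear_simps(5)[OF assms])

end

section \<open>Functions of finitely many digits\<close>

text \<open>The sequences that share their first m digits with x form an open cylinder on which h is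
  constant; as h is locally constant, its target may be any topological space.\<close>

lemma continuous_on_digits:
  fixes h :: "(nat \<Rightarrow> nat) \<Rightarrow> 'b::topological_space"
  assumes "\<And>x y. (\<forall>i<m. x i = y i) \<Longrightarrow> h x = h y"
  shows "continuous_on S h"
proof -
  have "open (h -` U)" for U
  proof (rule Topological_Spaces.openI)
    fix x assume x: "x \<in> h -` U"
    have "open {y :: nat \<Rightarrow> nat. \<forall>i\<in>{..<m}. y (id i) \<in> {x i}}"
      by (rule product_topology_basis') (simp_all add: Topological_Spaces.open_discrete)
    moreover have "{y. \<forall>i\<in>{..<m}. y (id i) \<in> {x i}} \<subseteq> h -` U"
    proof
      fix y assume "y \<in> {y. \<forall>i\<in>{..<m}. y (id i) \<in> {x i}}"
      then have "h y = h x" by (intro assms) auto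
      with x show "y \<in> h -` U" by simp
    qed
    ultimately show "\<exists>V. open V \<and> x \<in> V \<and> V \<subseteq> h -` U"
      by (intro exI[of _ "{y. \<forall>i\<in>{..<m}. y (id i) \<in> {x i}}"]) auto
  qed
  then have "continuous_on UNIV h"
    by (simp add: continuous_on_open_vimage)
  then show ?thesis
    by (rule continuous_on_subset) simp
qed

text \<open>The distance is at most twice the largest distance in the coordinates from_nat 0, ...,
  from_nat n, plus a tail (1/2)^n. As \<open>m\<close> exceeds all these coordinate indices, only
  the tail remains.\<close>

lemma digits_dist_less:
  assumes "e > (0::real)"
  obtains m where "\<And>x y :: nat \<Rightarrow> nat. (\<forall>i<m. x i = y i) \<Longrightarrow> dist x y < e"
proof -
  obtain n where n: "(1/2::real) ^ n < e"
    using real_arch_pow_inv[of e "1/2"] assms by auto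
  define m where "m = Suc (Max ((\<lambda>k. from_nat k :: nat) ` {..n}))"
  have "dist x y < e" if "\<forall>i<m. x i = y i" for x y :: "nat \<Rightarrow> nat"
  proof -
    have "from_nat k < m" if "k \<le> n" for k
      using that by (auto simp: m_def less_Suc_eq_le intro!: Max_ge)
    then have "{dist (x (from_nat k)) (y (from_nat k)) |k. k \<le> n} = {0}"
      using \<open>\<forall>i<m. x i = y i\<close> by (auto intro: exI[of _ 0])
    then show ?thesis
      using dist_fun_le_dist_first_terms[of x y n] n by simp
  qed
  then show ?thesis using that by blast
qed

text \<open>Uniform continuity on a compact set, read in digits. It drives the uniform convergence
  of P_M \<phi> to \<phi>.\<close>

lemma continuous_on_compact_digits:
  fixes \<phi> :: "(nat \<Rightarrow> nat) \<Rightarrow> real"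
  assumes "compact K" "continuous_on K \<phi>" "e > 0"
  obtains m where "\<And>x y. x \<in> K \<Longrightarrow> y \<in> K \<Longrightarrow> (\<forall>i<m. x i = y i) \<Longrightarrow> \<bar>\<phi> x - \<phi> y\<bar> < e"
proof -
  from compact_uniformly_continuous[OF assms(2,1)] assms(3)
  obtain r where r: "r > 0" "\<And>x y. x \<in> K \<Longrightarrow> y \<in> K \<Longrightarrow> dist y x < r \<Longrightarrow> dist (\<phi> y) (\<phi> x) < e"
    unfolding uniformly_continuous_on_def by metis
  obtain m where "\<And>x y :: nat \<Rightarrow> nat. (\<forall>i<m. x i = y i) \<Longrightarrow> dist x y < r"
    using digits_dist_less[OF r(1)] by blast
  with r(2) show ?thesis
    by (intro that[of m]) (auto simp: dist_real_def)
qed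

lemma Omega_digits: "(\<forall>i<r. x i = y i) \<Longrightarrow> Omega r a x = Omega r a y"
  by (simp add: Omega_def)

lemma JN_digits: "(\<forall>i<N. x i = x' i) \<Longrightarrow> JN p N G0 A x = JN p N G0 A x'"
  by (simp add: JN_def Omega_digits[of N x x'] fun_eq_iff)

lemma JN_digits_right: "(\<forall>i<N. y i = y' i) \<Longrightarrow> JN p N G0 A x y = JN p N G0 A x y'"
  by (simp add: JN_def Omega_digits[of N y y'])

lemma compact_Zp: "compact (Zp p)"
proof -
  have "Zp p = PiE UNIV (\<lambda>_. {..<p})"
    by (auto simp: Zp_def PiE_def)
  moreover have "compactin (product_topology (\<lambda>_::nat. euclidean :: nat topology) UNIV) (PiE UNIV (\<lambda>_. {..<p}))"
    by (simp add: compactin_PiE compactin_euclidean_iff finite_imp_compact)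
  ultimately show ?thesis
    by (simp add: euclidean_product_topology compactin_euclidean_iff)
qed

section \<open>The network operator on bounded continuous functions\<close>

text \<open>The sup norm controls the change in the first variable uniformly in the second, and the
  fixed function \<open>w (fst z)\<close> is continuous in the second. \<open>mild_range\<close>
  needs this joint continuity on [0,T] x K.\<close>

lemma continuous_bcontfun_eval:
  fixes w :: "'a::topological_space \<Rightarrow> ('b::topological_space \<Rightarrow>\<^sub>C real)"
  assumes "continuous_on D w"
  shows "continuous_on (D \<times> E) (\<lambda>z. apply_bcontfun (w (fst z)) (snd z))"
  unfolding continuous_on_def
proof
  fix z assume z: "z \<in> D \<times> E"
  have "continuous_on (D \<times> E) (\<lambda>y. w (fst y))"
    by (rule continuous_on_compose2[OF assms]) (auto intro!: continuous_intros)
  then have w: "((\<lambda>y. w (fst y)) \<longlongrightarrow> w (fst z)) (at z within D \<times> E)"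
    using z unfolding continuous_on_def by blast
  have "continuous_on (D \<times> E) (\<lambda>y. w (fst z) (snd y))"
    by (rule continuous_on_compose2[OF continuous_on_apply_bcontfun[of UNIV]])
       (auto intro!: continuous_intros)
  then have 1: "((\<lambda>y. w (fst z) (snd y)) \<longlongrightarrow> w (fst z) (snd z)) (at z within D \<times> E)"
    using z unfolding continuous_on_def by blast
  have "((\<lambda>y. (w (fst y) - w (fst z)) (snd y)) \<longlongrightarrow> 0) (at z within D \<times> E)"
  proof (rule Lim_null_comparison)
    show "\<forall>\<^sub>F y in at z within D \<times> E.
        norm ((w (fst y) - w (fst z)) (snd y)) \<le> norm (w (fst y) - w (fst z))"
      by (intro always_eventually allI norm_bounded)
    show "((\<lambda>y. norm (w (fst y) - w (fst z))) \<longlongrightarrow> 0) (at z within D \<times> E)"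
      using tendsto_norm[OF tendsto_diff[OF w tendsto_const], of "w (fst z)"] by simp
  qed
  from tendsto_add[OF this 1]
  show "((\<lambda>y. w (fst y) (snd y)) \<longlongrightarrow> w (fst z) (snd z)) (at z within D \<times> E)"
    by simp
qed

lemma bounded_linear_eval: "bounded_linear (\<lambda>\<phi> :: 'a::topological_space \<Rightarrow>\<^sub>C real. apply_bcontfun \<phi> x)"
proof (rule bounded_linear_intro[where K = 1])
  show "norm (apply_bcontfun \<phi> x) \<le> norm \<phi> * 1" for \<phi> :: "'a \<Rightarrow>\<^sub>C real"
    using norm_bounded[of \<phi> x] by simp
qed simp_all

type_synonym bcf = "(nat \<Rightarrow> nat) \<Rightarrow>\<^sub>C real"

locale network =
  fixes p N :: nat and G0 :: "(nat \<Rightarrow> nat) set" and A :: "(nat \<Rightarrow> nat) \<Rightarrow> (nat \<Rightarrow> nat) \<Rightarrow> real"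
  assumes p_pos: "0 < p" and finite_G0: "finite G0" and G0_ne: "G0 \<noteq> {}" and G0_Zp: "G0 \<subseteq> Zp p"
begin

abbreviation "K \<equiv> KN p N G0"
abbreviation "L \<equiv> Lop p N G0 A"
abbreviation "J \<equiv> JN p N G0 A"

text \<open>A continuous retraction of all digit sequences onto \<open>K\<close>.  It identifies \<open>C(K)\<close> with a
  subspace of the Banach space of bounded continuous functions on the whole type.\<close>
definition retr :: "(nat \<Rightarrow> nat) \<Rightarrow> nat \<Rightarrow> nat" where
  "retr x = (if \<exists>I\<in>G0. \<forall>i<N. x i = I i then (\<lambda>i. min (x i) (p - 1)) else (SOME I. I \<in> G0))"

lemma some_G0: "(SOME I. I \<in> G0) \<in> G0"
  using G0_ne by (simp add: some_in_eq)

lemma G0_K: "G0 \<subseteq> K"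
  using G0_Zp by (auto simp: KN_def)

lemma K_ne: "K \<noteq> {}"
  using G0_K G0_ne by auto

lemma retr_in_K: "retr x \<in> K"
proof (cases "\<exists>I\<in>G0. \<forall>i<N. x i = I i")
  case True
  then obtain I where I: "I \<in> G0" "\<forall>i<N. x i = I i" by auto
  have "I i < p" for i
    using I(1) G0_Zp by (auto simp: Zp_def)
  then have "min (x i) (p - 1) = I i" if "i < N" for i
    using I(2) that by (metis Suc_diff_1 less_Suc_eq_le min.absorb1 p_pos)
  moreover have "min n (p - 1) < p" for n
    using p_pos by auto
  ultimately show ?thesis
    using True I(1) by (auto simp: retr_def KN_def Zp_def)
next
  case False
  then show ?thesis
    using some_G0 G0_K by (simp only: retr_def if_False subset_iff)
qed

lemma retr_id:
  assumes "x \<in> K"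
  shows "retr x = x"
proof -
  have "x i \<le> p - 1" for i
  proof -
    have "x i < p"
      using assms by (simp add: KN_def Zp_def)
    then show ?thesis by linarith
  qed
  moreover have "\<exists>I\<in>G0. \<forall>i<N. x i = I i"
    using assms by (simp add: KN_def)
  ultimately show ?thesis
    by (simp add: retr_def min.absorb1)
qed

lemma continuous_retr: "continuous_on S retr"
proof (rule continuous_on_coordinatewise_then_product)
  fix i
  show "continuous_on S (\<lambda>x. retr x i)"
  proof (rule continuous_on_digits[of "max N (Suc i)"])
    fix x y :: "nat \<Rightarrow> nat" assume "\<forall>j<max N (Suc i). x j = y j"
    then have "x i = y i" "\<forall>j<N. x j = y j" by auto
    then have "(\<exists>I\<in>G0. \<forall>j<N. x j = I j) \<longleftrightarrow> (\<exists>I\<in>G0. \<forall>j<N. y j = I j)" by simp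
    with \<open>x i = y i\<close> show "retr x i = retr y i" by (simp only: retr_def if_distribR)
  qed
qed

text \<open>\<open>retr\<close> fixes \<open>K\<close> pointwise and maps everything into it, so
  \<open>K\<close> is a continuous image of the compact set \<open>Zp p\<close>.\<close>

lemma compact_K: "compact K"
proof -
  have "K = retr ` Zp p"
  proof
    show "K \<subseteq> retr ` Zp p"
    proof
      fix x assume "x \<in> K"
      then show "x \<in> retr ` Zp p"
        by (intro image_eqI[of x retr x]) (simp_all add: retr_id, simp add: KN_def)
    qed
  qed (use retr_in_K in auto)
  then show ?thesis
    using compact_continuous_image[OF continuous_retr compact_Zp] by simp
qed

section \<open>Haar measure and integrals against the kernel\<close>

lemma K_borel: "K \<in> sets borel"
  using compact_K by (simp add: compact_imp_closed)

lemma prob_space_haar: "prob_space (haar p)"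
  unfolding haar_def using p_pos
  by (intro prob_space_PiM prob_space_uniform_count_measure) auto

text \<open>\<open>haar\<close> carries the product sigma-algebra of finite discrete spaces, while
  continuous functions are measurable for the Borel sets of the product topology; coordinatewise
  measurability of the identity links the two.\<close>

lemma measurable_haar_borel: "(\<lambda>x. x) \<in> measurable (haar p) borel"
proof -
  have "(\<lambda>x. x i) \<in> measurable (haar p) borel" for i
  proof -
    have "(\<lambda>x. x i) \<in> measurable (haar p) (uniform_count_measure {0..<p})"
      unfolding haar_def by (rule measurable_component_singleton) simp
    moreover have "(\<lambda>n. n) \<in> measurable (uniform_count_measure {0..<p}) (borel :: nat measure)"
      by (simp add: measurable_def space_uniform_count_measure sets_uniform_count_measure)
    ultimately show ?thesis
      by (rule measurable_compose)
  qed
  then have "(\<lambda>x. x) \<in> measurable (haar p) (PiM UNIV (\<lambda>_. borel))"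
    by (intro measurable_PiM_single') auto
  then show ?thesis
    using measurable_cong_sets[OF refl sets_PiM_equal_borel] by blast
qed

definition J_bound :: real where
  "J_bound = real p ^ N * (\<Sum>J\<in>G0. \<Sum>K\<in>G0. \<bar>A J K\<bar>)"

lemma J_bound_nonneg: "0 \<le> J_bound"
  by (simp add: J_bound_def sum_nonneg)

lemma abs_J_le: "\<bar>J x y\<bar> \<le> J_bound"
proof -
  have "\<bar>\<Sum>J\<in>G0. \<Sum>K\<in>G0. A J K * Omega N J x * Omega N K y\<bar> \<le> (\<Sum>J\<in>G0. \<Sum>K\<in>G0. \<bar>A J K\<bar>)"
    by (rule order_trans[OF sum_abs], rule sum_mono, rule order_trans[OF sum_abs], rule sum_mono)
       (simp add: Omega_def)
  then show ?thesis
    by (simp add: JN_def J_bound_def abs_mult mult_left_mono)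
qed

text \<open>The integrand is bounded and Borel measurable, and \<open>haar\<close> has total mass 1,
  so a bound on the integrand also bounds the integral.\<close>

lemma integrable_J:
  fixes h :: "(nat \<Rightarrow> nat) \<Rightarrow> real"
  assumes "continuous_on UNIV h" "\<And>y. \<bar>h y\<bar> \<le> B"
  shows "set_integrable (haar p) K (\<lambda>y. h y * J x y)"
    and "\<bar>LINT y : K | haar p. h y * J x y\<bar> \<le> B * J_bound"
proof -
  interpret prob_space "haar p" by (rule prob_space_haar)
  have "continuous_on UNIV (J x)"
    by (rule continuous_on_digits) (rule JN_digits_right)
  then have "(\<lambda>y. indicator K y *\<^sub>R (h y * J x y)) \<in> borel_measurable borel"
    using assms(1)
    by (intro borel_measurable_continuous_on_indicator K_borel continuous_intros)
       (auto intro: continuous_on_subset)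
  from measurable_compose[OF measurable_haar_borel this]
  have meas: "(\<lambda>y. indicator K y *\<^sub>R (h y * J x y)) \<in> borel_measurable (haar p)" .
  have B: "0 \<le> B"
    using assms(2) abs_ge_zero order_trans by blast
  have le: "norm (indicator K y *\<^sub>R (h y * J x y)) \<le> B * J_bound" for y
    using mult_mono[OF assms(2) abs_J_le B abs_ge_zero] B J_bound_nonneg
    by (auto simp: indicator_def abs_mult)
  show int: "set_integrable (haar p) K (\<lambda>y. h y * J x y)"
    unfolding set_integrable_def by (rule integrable_const_bound[OF _ meas]) (use le in auto)
  have "\<bar>LINT y : K | haar p. h y * J x y\<bar>
      \<le> (LINT y | haar p. norm (indicator K y *\<^sub>R (h y * J x y)))"
    unfolding set_lebesgue_integral_def real_norm_def[symmetric] by (rule integral_norm_bound)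
  also have "\<dots> \<le> B * J_bound"
    using int le unfolding set_integrable_def by (intro integral_le_const) auto
  finally show "\<bar>LINT y : K | haar p. h y * J x y\<bar> \<le> B * J_bound" .
qed

text \<open>The integration runs over \<open>K\<close> only, so a function given on \<open>K\<close>
  may be replaced by a continuous extension to all digit sequences.\<close>

lemma L_cong: "(\<And>y. y \<in> K \<Longrightarrow> \<phi> y = \<psi> y) \<Longrightarrow> x \<in> K \<Longrightarrow> L \<phi> x = L \<psi> x"
  unfolding Lop_def set_lebesgue_integral_def
  by (rule Bochner_Integration.integral_cong) (auto simp: indicator_def)

text \<open>The point x enters \<open>L\<close> only through the value at x and the kernel, which
  sees N digits of x. Hence functions of the first M >= N digits are preserved.\<close>

lemma L_digits: "(\<forall>i<N. x i = y i) \<Longrightarrow> \<phi> x = \<phi> y \<Longrightarrow> L \<phi> x = L \<phi> y"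
  by (simp add: Lop_def JN_digits[of N x y])

lemma abs_diff_eval_le: "\<bar>apply_bcontfun \<phi> y - apply_bcontfun \<phi> x\<bar> \<le> 2 * norm (\<phi> :: bcf)"
  using norm_bounded[of \<phi> x] norm_bounded[of \<phi> y] by simp

text \<open>Once the difference is split, both integrals depend on x only through its first N
  digits, hence are locally constant; the remaining factor \<phi> x is continuous.\<close>

lemma continuous_L:
  fixes \<phi> :: bcf
  shows "continuous_on S (L \<phi>)"
proof -
  have int: "set_integrable (haar p) K (\<lambda>y. \<phi> y * J x y)"
    "set_integrable (haar p) K (\<lambda>y. \<phi> z * J x y)" for x z
    using norm_bounded[of \<phi>] by (auto intro!: integrable_J continuous_intros)
  have "L \<phi> = (\<lambda>x. (LINT y : K | haar p. \<phi> y * J x y) - \<phi> x * (LINT y : K | haar p. J x y))"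
    unfolding Lop_def left_diff_distrib
    by (subst set_integral_diff(2)[OF int]) simp
  moreover have "continuous_on S (\<lambda>x. LINT y : K | haar p. h y * J x y)" for h
    by (rule continuous_on_digits[of N]) (simp only: JN_digits)
  from this[of "\<lambda>_. 1"] this[of \<phi>] have "continuous_on S
      (\<lambda>x. (LINT y : K | haar p. \<phi> y * J x y) - \<phi> x * (LINT y : K | haar p. J x y))"
    by (intro continuous_intros) auto
  ultimately show ?thesis by simp
qed

text \<open>Composing with \<open>retr\<close> changes nothing on \<open>K\<close> and makes every
  output invariant under \<open>retr\<close>, so that an equation checked on \<open>K\<close>
  extends to all digit sequences.\<close>

definition Lhat :: "bcf \<Rightarrow> bcf" where
  "Lhat \<phi> = Bcontfun (\<lambda>x. L \<phi> (retr x))"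

lemma abs_L_le: "\<bar>L (apply_bcontfun \<phi>) x\<bar> \<le> 2 * J_bound * norm \<phi>"
proof -
  have "\<bar>LINT y : K | haar p. (\<phi> y - \<phi> x) * J x y\<bar> \<le> 2 * norm \<phi> * J_bound"
    by (intro integrable_J(2) abs_diff_eval_le continuous_intros continuous_on_apply_bcontfun)
  then show ?thesis
    by (simp add: Lop_def mult_ac)
qed

lemma Lhat_apply: "Lhat \<phi> x = L \<phi> (retr x)"
proof -
  have "(\<lambda>x. L \<phi> (retr x)) \<in> bcontfun"
    using abs_L_le[of \<phi>]
    by (intro bcontfun_normI[where b = "2 * J_bound * norm \<phi>"]
          continuous_on_compose2[OF continuous_L[of UNIV]] continuous_retr) auto
  then show ?thesis
    by (simp add: Lhat_def Bcontfun_inverse)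
qed

lemma norm_Lhat: "norm (Lhat \<phi>) \<le> 2 * J_bound * norm \<phi>"
  by (rule norm_bound) (simp add: Lhat_apply abs_L_le)

lemma linear_Lhat: "linear Lhat"
proof (rule linearI)
  fix \<phi> \<psi> :: bcf and c :: real
  have int: "set_integrable (haar p) K (\<lambda>y. (\<phi> y - \<phi> x) * J x y)" for x and \<phi> :: bcf
    using abs_diff_eval_le[of \<phi> _ x] by (intro integrable_J continuous_intros) auto
  show "Lhat (\<phi> + \<psi>) = Lhat \<phi> + Lhat \<psi>"
  proof (rule bcontfun_eqI)
    fix x
    let ?x = "retr x"
    have "L (\<phi> + \<psi>) ?x = (LINT y : K | haar p. (\<phi> y - \<phi> ?x) * J ?x y + (\<psi> y - \<psi> ?x) * J ?x y)"
      unfolding Lop_def by (simp add: algebra_simps)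
    also have "\<dots> = L \<phi> ?x + L \<psi> ?x"
      unfolding Lop_def by (rule set_integral_add(2)[OF int int])
    finally show "Lhat (\<phi> + \<psi>) x = (Lhat \<phi> + Lhat \<psi>) x"
      by (simp add: Lhat_apply)
  qed
  show "Lhat (c *\<^sub>R \<phi>) = c *\<^sub>R Lhat \<phi>"
  proof (rule bcontfun_eqI)
    fix x
    let ?x = "retr x"
    have "L (c *\<^sub>R \<phi>) ?x = (LINT y : K | haar p. c * ((\<phi> y - \<phi> ?x) * J ?x y))"
      unfolding Lop_def by (simp add: algebra_simps)
    also have "\<dots> = c * L \<phi> ?x"
      unfolding Lop_def by (rule set_integral_mult_right)
    finally show "Lhat (c *\<^sub>R \<phi>) x = (c *\<^sub>R Lhat \<phi>) x"
      by (simp add: Lhat_apply)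
  qed
qed

abbreviation "Texp \<equiv> op_exp Lhat"

lemma L_bound_nonneg: "0 \<le> 2 * J_bound"
  using J_bound_nonneg by simp

lemmas Texp_suminf = bounded_linear_op_exp_suminf[OF linear_Lhat norm_Lhat L_bound_nonneg]

text \<open>By \<open>L_cong\<close> the iterates of \<open>L\<close> and \<open>Lhat\<close> agree
  on \<open>K\<close> whatever \<phi> does elsewhere; evaluation at x then goes through the series
  term by term.\<close>

lemma expL_eq:
  assumes "x \<in> K" "\<And>y. y \<in> K \<Longrightarrow> \<phi> y = apply_bcontfun \<Phi> y"
  shows "expL p N G0 A t \<phi> x = Texp t \<Phi> x"
proof -
  have "(L ^^ n) \<phi> y = (Lhat ^^ n) \<Phi> y" if "y \<in> K" for n y
    using that
  proof (induction n arbitrary: y)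
    case (Suc n)
    then have "L ((L ^^ n) \<phi>) y = L ((Lhat ^^ n) \<Phi>) y"
      by (intro L_cong) auto
    then show ?case
      using Suc.prems by (simp add: Lhat_apply retr_id)
  qed (simp add: assms(2))
  then show ?thesis
    using assms(1) by (simp add: expL_def Texp_suminf[OF bounded_linear_eval])
qed

lemma Texp_retr:
  assumes "\<And>x. apply_bcontfun \<Phi> (retr x) = apply_bcontfun \<Phi> x"
  shows "Texp t \<Phi> (retr x) = Texp t \<Phi> x"
proof -
  have "(Lhat ^^ n) \<Phi> (retr x) = (Lhat ^^ n) \<Phi> x" for n
    by (cases n) (simp_all add: assms Lhat_apply retr_id retr_in_K)
  then show ?thesis
    by (simp add: Texp_suminf[OF bounded_linear_eval])
qed

text \<open>By \<open>L_digits\<close> every iterate is still determined by the first M digits, and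
  the series are compared term by term: the exponential preserves X_M.\<close>

lemma Texp_digits:
  assumes "N \<le> M"
    and "\<And>x y. x \<in> K \<Longrightarrow> y \<in> K \<Longrightarrow> \<forall>i<M. x i = y i \<Longrightarrow> apply_bcontfun \<Phi> x = apply_bcontfun \<Phi> y"
    and "x \<in> K" "y \<in> K" "\<forall>i<M. x i = y i"
  shows "Texp t \<Phi> x = Texp t \<Phi> y"
proof -
  have "(Lhat ^^ n) \<Phi> x = (Lhat ^^ n) \<Phi> y" for n
  proof (induction n)
    case (Suc n)
    then show ?case
      using assms(1,3-5) by (simp add: Lhat_apply retr_id L_digits)
  qed (simp add: assms(2)[OF assms(3-5)])
  then show ?thesis
    by (simp add: Texp_suminf[OF bounded_linear_eval])
qed

text \<open>The embedding of C(K). \<open>Bcontfun\<close> is meaningful only on bounded continuous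
  functions, whence the premise \<open>continuous_on K\<close> in the lemmas on
  \<open>ext\<close>.\<close>

definition ext :: "((nat \<Rightarrow> nat) \<Rightarrow> real) \<Rightarrow> bcf" where
  "ext \<phi> = Bcontfun (\<lambda>x. \<phi> (retr x))"

lemma ext_apply:
  assumes "continuous_on K \<phi>"
  shows "ext \<phi> x = \<phi> (retr x)"
proof -
  have "bounded (\<phi> ` K)"
    using compact_continuous_image[OF assms compact_K] by (rule compact_imp_bounded)
  then obtain B where "\<And>x. x \<in> K \<Longrightarrow> norm (\<phi> x) \<le> B"
    unfolding bounded_iff by blast
  then have "(\<lambda>x. \<phi> (retr x)) \<in> bcontfun"
    using retr_in_K
    by (intro bcontfun_normI[where b = B] continuous_on_compose2[OF assms] continuous_retr) auto
  then show ?thesis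
    by (simp add: ext_def Bcontfun_inverse)
qed

lemma ext_eq: "continuous_on K \<phi> \<Longrightarrow> x \<in> K \<Longrightarrow> ext \<phi> x = \<phi> x"
  by (simp add: ext_apply retr_id)

lemma ext_retr: "continuous_on K \<phi> \<Longrightarrow> ext \<phi> (retr x) = ext \<phi> x"
  by (simp add: ext_apply retr_id retr_in_K)

lemma norm_ext_diff_le:
  assumes "continuous_on K \<phi>" "continuous_on K \<psi>" "\<And>x. x \<in> K \<Longrightarrow> \<bar>\<phi> x - \<psi> x\<bar> \<le> e"
  shows "norm (ext \<phi> - ext \<psi>) \<le> e"
  using assms retr_in_K by (intro norm_bound) (simp add: ext_apply)

lemma norm_ext_diff_le_supdist:
  assumes "continuous_on K \<phi>" "continuous_on K \<psi>"
  shows "norm (ext \<phi> - ext \<psi>) \<le> supdist K \<phi> \<psi>"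
proof (rule norm_ext_diff_le[OF assms])
  fix x assume "x \<in> K"
  \<comment> \<open>A real \<open>SUP\<close> bounds its members only if they are bounded above;
    compactness of \<open>K\<close> ensures this.\<close>
  moreover have "compact ((\<lambda>x. \<bar>\<phi> x - \<psi> x\<bar>) ` K)"
    using assms by (intro compact_continuous_image compact_K continuous_intros)
  ultimately show "\<bar>\<phi> x - \<psi> x\<bar> \<le> supdist K \<phi> \<psi>"
    unfolding supdist_def
    by (intro cSUP_upper bounded_imp_bdd_above compact_imp_bounded)
qed

lemma supdist_le: "(\<And>x. x \<in> K \<Longrightarrow> \<bar>\<phi> x - \<psi> x\<bar> \<le> e) \<Longrightarrow> supdist K \<phi> \<psi> \<le> e"
  unfolding supdist_def using K_ne by (rule cSUP_least)

end

lemma norm_fst_le_norm: "norm (fst z) \<le> norm z"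
  by (metis norm_fst_le prod.collapse)

lemma norm_snd_le_norm: "norm (snd z) \<le> norm z"
  by (metis norm_snd_le prod.collapse)

lemma abs_fst_eval_le: "\<bar>apply_bcontfun (fst W) x\<bar> \<le> norm (W :: bcf \<times> bcf)"
  using order_trans[OF norm_bounded norm_fst_le_norm, of W x] by simp

lemma abs_snd_eval_le: "\<bar>apply_bcontfun (snd W) x\<bar> \<le> norm (W :: bcf \<times> bcf)"
  using order_trans[OF norm_bounded norm_snd_le_norm, of W x] by simp

section \<open>Truncation of the nonlinearity to a box\<close>

definition clip :: "real \<Rightarrow> real \<Rightarrow> (real \<Rightarrow> real \<Rightarrow> real) \<Rightarrow> real \<Rightarrow> real \<Rightarrow> real" where
  "clip \<alpha> \<beta> f r s = f (max \<alpha> (min \<beta> r)) (max \<alpha> (min \<beta> s))"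

lemma clip_eq: "r \<in> {\<alpha>..\<beta>} \<Longrightarrow> s \<in> {\<alpha>..\<beta>} \<Longrightarrow> clip \<alpha> \<beta> f r s = f r s"
  by (simp add: clip_def max_absorb2 min_absorb2)

definition bounded_lipschitz :: "real \<Rightarrow> real \<Rightarrow> (real \<Rightarrow> real \<Rightarrow> real) \<Rightarrow> bool" where
  "bounded_lipschitz \<Lambda> B h \<longleftrightarrow> 0 \<le> \<Lambda> \<and> (\<forall>r s. \<bar>h r s\<bar> \<le> B) \<and>
     (\<forall>r s r' s'. \<bar>h r s - h r' s'\<bar> \<le> \<Lambda> * (\<bar>r - r'\<bar> + \<bar>s - s'\<bar>))"

text \<open>The gradient is bounded on the compact convex box, so the mean value inequality makes f
  Lipschitz there; the projection onto the box is 1-Lipschitz in each coordinate and carries this to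
  the whole plane.\<close>

lemma C1_bounded_lipschitz_clip:
  assumes f: "C1_grad a b f" and "a < \<alpha>" "\<alpha> \<le> \<beta>" "\<beta> < b"
  obtains \<Lambda> B where "bounded_lipschitz \<Lambda> B (clip \<alpha> \<beta> f)"
proof -
  let ?Q = "{\<alpha>..\<beta>} \<times> {\<alpha>..\<beta>}" and ?f = "\<lambda>w. f (fst w) (snd w)"
  obtain Df where cont: "continuous_on ({a<..<b} \<times> {a<..<b}) Df"
    and der: "\<And>z. z \<in> {a<..<b} \<times> {a<..<b} \<Longrightarrow> (?f has_derivative (\<lambda>h. Df z \<bullet> h)) (at z)"
    using f unfolding C1_grad_def by blast
  have sub: "?Q \<subseteq> {a<..<b} \<times> {a<..<b}"
    using assms by auto
  have compact: "compact ?Q"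
    by (intro compact_Times) auto
  have "bounded (Df ` ?Q)"
    by (intro compact_imp_bounded compact_continuous_image compact continuous_on_subset[OF cont sub])
  then obtain \<Lambda> where \<Lambda>: "\<And>z. z \<in> ?Q \<Longrightarrow> norm (Df z) \<le> \<Lambda>"
    unfolding bounded_iff by blast
  have "(\<alpha>, \<alpha>) \<in> ?Q" using assms by auto
  from \<Lambda>[OF this] have \<Lambda>_nonneg: "0 \<le> \<Lambda>"
    using norm_ge_zero order_trans by blast
  have lip: "\<bar>?f z - ?f z'\<bar> \<le> \<Lambda> * norm (z - z')" if "z \<in> ?Q" "z' \<in> ?Q" for z z'
    unfolding real_norm_def[symmetric]
  proof (rule differentiable_bound[of ?Q ?f "\<lambda>z h. Df z \<bullet> h"])
    show "convex ?Q" by (intro convex_Times) auto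
    fix y assume y: "y \<in> ?Q"
    show "(?f has_derivative (\<lambda>h. Df y \<bullet> h)) (at y within ?Q)"
      by (rule has_derivative_at_withinI[OF der[OF subsetD[OF sub y]]])
    show "onorm (\<lambda>h. Df y \<bullet> h) \<le> \<Lambda>"
    proof (rule onorm_bound[OF \<Lambda>_nonneg])
      fix h
      have "norm (Df y \<bullet> h) \<le> norm (Df y) * norm h"
        by (rule Cauchy_Schwarz_ineq2[folded real_norm_def])
      also have "\<dots> \<le> \<Lambda> * norm h"
        using \<Lambda>[OF y] by (rule mult_right_mono) simp
      finally show "norm (Df y \<bullet> h) \<le> \<Lambda> * norm h" .
    qed
  qed (use that in auto)
  have "continuous_on ?Q ?f"
    using has_derivative_at_withinI[OF der[OF subsetD[OF sub]]]
    by (rule has_derivative_continuous_on)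
  then have "bounded (?f ` ?Q)"
    by (intro compact_imp_bounded compact_continuous_image compact)
  then obtain B where B: "\<And>z. z \<in> ?Q \<Longrightarrow> norm (?f z) \<le> B"
    unfolding bounded_iff by blast
  let ?c = "\<lambda>r. max \<alpha> (min \<beta> r)"
  have c: "(?c r, ?c s) \<in> ?Q" for r s
    using assms by auto
  have "\<bar>clip \<alpha> \<beta> f r s - clip \<alpha> \<beta> f r' s'\<bar> \<le> \<Lambda> * (\<bar>r - r'\<bar> + \<bar>s - s'\<bar>)" for r s r' s'
  proof -
    have "\<bar>clip \<alpha> \<beta> f r s - clip \<alpha> \<beta> f r' s'\<bar> \<le> \<Lambda> * norm ((?c r, ?c s) - (?c r', ?c s'))"
      using lip[OF c c, of r s r' s'] by (simp add: clip_def)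
    also have "norm ((?c r, ?c s) - (?c r', ?c s')) \<le> \<bar>?c r - ?c r'\<bar> + \<bar>?c s - ?c s'\<bar>"
      using norm_Pair_le[of "?c r - ?c r'" "?c s - ?c s'"] by simp
    also have "\<dots> \<le> \<bar>r - r'\<bar> + \<bar>s - s'\<bar>"
      by (auto simp: max_def min_def)
    finally show ?thesis
      using \<Lambda>_nonneg by (simp add: mult_left_mono)
  qed
  moreover have "\<bar>clip \<alpha> \<beta> f r s\<bar> \<le> B" for r s
    using B[OF c] by (simp add: clip_def)
  ultimately show ?thesis
    using \<Lambda>_nonneg that unfolding bounded_lipschitz_def by blast
qed

section \<open>Superposition operators on pairs of bounded continuous functions\<close>

definition nemytskii :: "(real \<Rightarrow> real \<Rightarrow> real) \<Rightarrow> bcf \<times> bcf \<Rightarrow> bcf" where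
  "nemytskii h W = Bcontfun (\<lambda>x. h (fst W x) (snd W x))"

lemma nemytskii_apply:
  assumes "bounded_lipschitz \<Lambda> B h"
  shows "nemytskii h W x = h (fst W x) (snd W x)"
proof -
  have "(\<Lambda> * 2)-lipschitz_on UNIV (\<lambda>z. h (fst z) (snd z))"
  proof (rule lipschitz_onI)
    fix z z' :: "real \<times> real"
    have "\<bar>h (fst z) (snd z) - h (fst z') (snd z')\<bar>
        \<le> \<Lambda> * (\<bar>fst z - fst z'\<bar> + \<bar>snd z - snd z'\<bar>)"
      using assms by (simp add: bounded_lipschitz_def)
    also have "\<dots> \<le> \<Lambda> * (norm (z - z') + norm (z - z'))"
      using norm_fst_le_norm[of "z - z'"] norm_snd_le_norm[of "z - z'"] assms
      by (intro mult_left_mono add_mono) (simp_all add: bounded_lipschitz_def)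
    finally show "dist (h (fst z) (snd z)) (h (fst z') (snd z')) \<le> \<Lambda> * 2 * dist z z'"
      by (simp add: dist_norm)
  qed (use assms in \<open>simp add: bounded_lipschitz_def\<close>)
  then have "continuous_on UNIV (\<lambda>z. h (fst z) (snd z))"
    by (rule lipschitz_on_continuous_on)
  then have "continuous_on UNIV (\<lambda>x. h (fst W x) (snd W x))"
    using continuous_on_compose2[of UNIV "\<lambda>z. h (fst z) (snd z)" UNIV "\<lambda>x. (fst W x, snd W x)"]
    by (simp add: continuous_on_Pair)
  then have "(\<lambda>x. h (fst W x) (snd W x)) \<in> bcontfun"
    using assms by (intro bcontfun_normI[where b = B]) (simp_all add: bounded_lipschitz_def)
  then show ?thesis
    by (simp add: nemytskii_def Bcontfun_inverse)
qed

lemma norm_nemytskii_diff_le: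
  assumes "bounded_lipschitz \<Lambda> B h"
  shows "norm (nemytskii h W - nemytskii h W') \<le> 2 * \<Lambda> * norm (W - W')"
proof (rule norm_bound)
  fix x
  have "\<bar>h (fst W x) (snd W x) - h (fst W' x) (snd W' x)\<bar>
      \<le> \<Lambda> * (\<bar>fst W x - fst W' x\<bar> + \<bar>snd W x - snd W' x\<bar>)"
    using assms by (simp add: bounded_lipschitz_def)
  also have "\<dots> \<le> \<Lambda> * (norm (W - W') + norm (W - W'))"
    using abs_fst_eval_le[of "W - W'" x] abs_snd_eval_le[of "W - W'" x] assms
    by (intro mult_left_mono add_mono) (simp_all add: bounded_lipschitz_def)
  finally show "norm ((nemytskii h W - nemytskii h W') x) \<le> 2 * \<Lambda> * norm (W - W')"
    by (simp add: nemytskii_apply[OF assms])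
qed

definition nemytskii_pair :: "(real \<Rightarrow> real \<Rightarrow> real) \<Rightarrow> (real \<Rightarrow> real \<Rightarrow> real) \<Rightarrow> bcf \<times> bcf \<Rightarrow> bcf \<times> bcf" where
  "nemytskii_pair h k W = (nemytskii h W, nemytskii k W)"

lemma lipschitz_nemytskii_pair:
  assumes "bounded_lipschitz \<Lambda> B h" "bounded_lipschitz \<Lambda>' B' k"
  shows "(2 * \<Lambda> + 2 * \<Lambda>')-lipschitz_on UNIV (nemytskii_pair h k)"
proof (rule lipschitz_onI)
  fix W W' :: "bcf \<times> bcf"
  have "dist (nemytskii_pair h k W) (nemytskii_pair h k W') \<le> norm (nemytskii h W - nemytskii h W') + norm (nemytskii k W - nemytskii k W')"
    using norm_Pair_le[of "nemytskii h W - nemytskii h W'" "nemytskii k W - nemytskii k W'"]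
    by (simp add: dist_norm nemytskii_pair_def)
  also have "\<dots> \<le> 2 * \<Lambda> * norm (W - W') + 2 * \<Lambda>' * norm (W - W')"
    using assms by (intro add_mono norm_nemytskii_diff_le)
  finally show "dist (nemytskii_pair h k W) (nemytskii_pair h k W') \<le> (2 * \<Lambda> + 2 * \<Lambda>') * dist W W'"
    by (simp add: dist_norm distrib_right)
qed (use assms in \<open>simp add: bounded_lipschitz_def\<close>)

section \<open>Mild solutions as solutions of an abstract mild equation\<close>

context network
begin

definition semi :: "real \<Rightarrow> real \<Rightarrow> real \<Rightarrow> bcf \<times> bcf \<Rightarrow> bcf \<times> bcf" where
  "semi \<epsilon> d t W = (Texp (\<epsilon> * t) (fst W), Texp (\<epsilon> * d * t) (snd W))"

lemma mild_equation_semi: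
  assumes "0 < \<epsilon>" "0 < d" "0 \<le> T"
    and "bounded_lipschitz \<Lambda> B h" "bounded_lipschitz \<Lambda>' B' k"
  obtains C where "mild_equation (semi \<epsilon> d) (nemytskii_pair h k) T C (2 * \<Lambda> + 2 * \<Lambda>')"
proof -
  \<comment> \<open>For t in [0,T] both \<epsilon> t and \<epsilon> d t lie in [0,R], so one
    constant \<open>c\<close> serves both exponentials.\<close>
  define R where "R = \<epsilon> * T + \<epsilon> * d * T"
  define c where "c = exp (R * (2 * J_bound))"
  have R: "0 \<le> \<epsilon> * t" "\<epsilon> * t \<le> R" "0 \<le> \<epsilon> * d * t" "\<epsilon> * d * t \<le> R" if "t \<in> {0..T}" for t
  proof -
    have "0 \<le> \<epsilon> * t" "0 \<le> \<epsilon> * d * t" "\<epsilon> * t \<le> \<epsilon> * T" "\<epsilon> * d * t \<le> \<epsilon> * d * T"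
      "0 \<le> \<epsilon> * T" "0 \<le> \<epsilon> * d * T"
      using that assms by (auto intro: mult_left_mono)
    then show "0 \<le> \<epsilon> * t" "\<epsilon> * t \<le> R" "0 \<le> \<epsilon> * d * t" "\<epsilon> * d * t \<le> R"
      unfolding R_def by linarith+
  qed
  have Texp_le: "norm (Texp t \<phi>) \<le> c * norm \<phi>" if "0 \<le> t" "t \<le> R" for t \<phi>
  proof -
    have "norm (Texp t \<phi>) \<le> exp (\<bar>t\<bar> * (2 * J_bound)) * norm \<phi>"
      by (rule norm_op_exp_le[OF linear_Lhat norm_Lhat L_bound_nonneg])
    also have "\<dots> \<le> c * norm \<phi>"
      unfolding c_def using that J_bound_nonneg by (intro mult_right_mono) (auto intro: mult_right_mono)
    finally show ?thesis .
  qed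
  have bl: "bounded_linear (Texp t)" for t
    by (rule bounded_linear_op_exp[OF linear_Lhat norm_Lhat L_bound_nonneg])
  have c: "0 \<le> c" by (simp add: c_def)
  show ?thesis
  \<comment> \<open>The 2 arises from bounding the norm of a pair by the sum of the norms of its
    components.\<close>
  proof (rule that[of "2 * c"], rule mild_equation.intro)
    show "bounded_linear (semi \<epsilon> d t)" for t
      unfolding semi_def
      by (intro bounded_linear_Pair bounded_linear_compose[OF bl] bounded_linear_fst bounded_linear_snd)
    show "norm (semi \<epsilon> d t W) \<le> 2 * c * norm W" if t: "t \<in> {0..T}" for t W
    proof -
      have "norm (semi \<epsilon> d t W) \<le> norm (Texp (\<epsilon> * t) (fst W)) + norm (Texp (\<epsilon> * d * t) (snd W))"
        unfolding semi_def by (rule norm_Pair_le)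
      also have "\<dots> \<le> c * norm (fst W) + c * norm (snd W)"
        using R[OF t] by (intro add_mono Texp_le)
      also have "\<dots> \<le> c * norm W + c * norm W"
        using c norm_fst_le_norm[of W] norm_snd_le_norm[of W] by (intro add_mono mult_left_mono)
      finally show ?thesis by simp
    qed
    have cont: "continuous_on {-R..R} (\<lambda>t. Texp t \<phi>)" for \<phi>
      by (rule continuous_op_exp[OF linear_Lhat norm_Lhat L_bound_nonneg])
    have sub: "(\<lambda>t. \<epsilon> * t) ` {0..T} \<subseteq> {-R..R}" "(\<lambda>t. \<epsilon> * d * t) ` {0..T} \<subseteq> {-R..R}"
      using R by force+
    show "continuous_on {0..T} (\<lambda>t. semi \<epsilon> d t W)" for W
      unfolding semi_def
      by (rule continuous_on_Pair; rule continuous_on_compose2[OF cont _ sub(1)] continuous_on_compose2[OF cont _ sub(2)];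
          intro continuous_intros)
    show "(2 * \<Lambda> + 2 * \<Lambda>')-lipschitz_on UNIV (nemytskii_pair h k)"
      by (rule lipschitz_nemytskii_pair[OF assms(4,5)])
  qed (use assms c in auto)
qed

text \<open>Evaluating one component at x is a bounded linear functional, hence commutes with the
  vector-valued integral and yields the pointwise integrals of \<open>mild\<close>.\<close>

lemma duhamel_eval:
  assumes "mild_equation (semi \<epsilon> d) F T C \<Lambda>" "continuous_on {0..T} h" "t \<in> {0..T}"
  shows "fst (mild_equation.duhamel (semi \<epsilon> d) h t) x
      = integral {0..t} (\<lambda>s. Texp (\<epsilon> * (t - s)) (fst (h s)) x)" (is ?thesis1)
    and "snd (mild_equation.duhamel (semi \<epsilon> d) h t) x
      = integral {0..t} (\<lambda>s. Texp (\<epsilon> * d * (t - s)) (snd (h s)) x)" (is ?thesis2)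
proof -
  interpret mild_equation "semi \<epsilon> d" F T C \<Lambda> by fact
  have int: "(\<lambda>s. semi \<epsilon> d (t - s) (h s)) integrable_on {0..t}"
    using assms(2,3) by (intro integrable_continuous_interval continuous_integrand)
  have eq: "l (duhamel h t) = integral {0..t} (\<lambda>s. l (semi \<epsilon> d (t - s) (h s)))"
    if "bounded_linear l" for l :: "bcf \<times> bcf \<Rightarrow> real"
    using integral_linear[OF int that] by (simp add: duhamel_def o_def)
  show ?thesis1
    using eq[OF bounded_linear_compose[OF bounded_linear_eval bounded_linear_fst]]
    by (simp add: semi_def)
  show ?thesis2
    using eq[OF bounded_linear_compose[OF bounded_linear_eval bounded_linear_snd]]
    by (simp add: semi_def)
qed

text \<open>While W stays in the box the truncated and the original nonlinearities coincide, and
  evaluation at points of \<open>K\<close> turns the abstract equation into the pointwise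
  one.\<close>

lemma mild_of_solves:
  fixes XS :: "((nat \<Rightarrow> nat) \<Rightarrow> real) \<Rightarrow> bool"
  assumes eqn: "mild_equation (semi \<epsilon> d) (nemytskii_pair h k) T C \<Lambda>0"
    and bl: "bounded_lipschitz \<Lambda> B h" "bounded_lipschitz \<Lambda>' B' k"
    and sol: "mild_equation.solves (semi \<epsilon> d) (nemytskii_pair h k) T W0 W"
    and init: "\<And>x. x \<in> K \<Longrightarrow> \<phi> x = fst W0 x" "\<And>x. x \<in> K \<Longrightarrow> \<psi> x = snd W0 x"
    and XS: "\<And>t. t \<in> {0..T} \<Longrightarrow> XS (fst (W t)) \<and> XS (snd (W t))"
    and range: "\<And>t x. t \<in> {0..T} \<Longrightarrow> x \<in> K \<Longrightarrow>
        fst (W t) x \<in> {\<alpha>..\<beta>} \<and> snd (W t) x \<in> {\<alpha>..\<beta>}"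
    and box: "a < \<alpha>" "\<beta> < b"
    and agree: "\<And>r s. r \<in> {\<alpha>..\<beta>} \<Longrightarrow> s \<in> {\<alpha>..\<beta>} \<Longrightarrow> h r s = f r s \<and> k r s = g r s"
  shows "mild p N G0 A a b f g \<epsilon> d XS (ereal T) \<phi> \<psi> (\<lambda>t. fst (W t)) (\<lambda>t. snd (W t))"
proof -
  interpret mild_equation "semi \<epsilon> d" "nemytskii_pair h k" T C \<Lambda>0 by fact
  have cont: "continuous_on {0..T} W"
    and eq: "\<And>t. t \<in> {0..T} \<Longrightarrow> W t = semi \<epsilon> d t W0 + duhamel (\<lambda>s. nemytskii_pair h k (W s)) t"
    using sol by (auto simp: solves_def)
  have eqs: "fst (W t) x = expL p N G0 A (\<epsilon> * t) \<phi> x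
          + integral {0..t} (\<lambda>s. expL p N G0 A (\<epsilon> * (t - s)) (\<lambda>y. f (fst (W s) y) (snd (W s) y)) x)"
    "snd (W t) x = expL p N G0 A (\<epsilon> * d * t) \<psi> x
          + integral {0..t} (\<lambda>s. expL p N G0 A (\<epsilon> * d * (t - s)) (\<lambda>y. g (fst (W s) y) (snd (W s) y)) x)"
    if t: "t \<in> {0..T}" and x: "x \<in> K" for t x
  proof -
    have nl: "f (fst (W s) y) (snd (W s) y) = nemytskii h (W s) y"
      "g (fst (W s) y) (snd (W s) y) = nemytskii k (W s) y" if "s \<in> {0..t}" "y \<in> K" for s y
      using range[of s y] agree t that by (auto simp: nemytskii_apply[OF bl(1)] nemytskii_apply[OF bl(2)])
    have "fst (W t) x = Texp (\<epsilon> * t) (fst W0) x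
        + integral {0..t} (\<lambda>s. Texp (\<epsilon> * (t - s)) (nemytskii h (W s)) x)"
      using duhamel_eval(1)[OF eqn continuous_F[OF cont] t, of x] by (subst eq[OF t]) (simp add: semi_def nemytskii_pair_def)
    also have "\<dots> = expL p N G0 A (\<epsilon> * t) \<phi> x
          + integral {0..t} (\<lambda>s. expL p N G0 A (\<epsilon> * (t - s)) (\<lambda>y. f (fst (W s) y) (snd (W s) y)) x)"
      using expL_eq[OF x init(1)] expL_eq[OF x nl(1)] by (auto intro!: arg_cong2[of _ _ _ _ "(+)"] integral_cong)
    finally show "fst (W t) x = \<dots>" .
    have "snd (W t) x = Texp (\<epsilon> * d * t) (snd W0) x
        + integral {0..t} (\<lambda>s. Texp (\<epsilon> * d * (t - s)) (nemytskii k (W s)) x)"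
      using duhamel_eval(2)[OF eqn continuous_F[OF cont] t, of x] by (subst eq[OF t]) (simp add: semi_def nemytskii_pair_def)
    also have "\<dots> = expL p N G0 A (\<epsilon> * d * t) \<psi> x
          + integral {0..t} (\<lambda>s. expL p N G0 A (\<epsilon> * d * (t - s)) (\<lambda>y. g (fst (W s) y) (snd (W s) y)) x)"
      using expL_eq[OF x init(2)] expL_eq[OF x nl(2)] by (auto intro!: arg_cong2[of _ _ _ _ "(+)"] integral_cong)
    finally show "snd (W t) x = \<dots>" .
  qed
  have cont_sup: "\<exists>\<delta>>0. \<forall>s\<in>{t. 0 \<le> t \<and> ereal t < ereal T}. \<bar>s - t\<bar> < \<delta> \<longrightarrow>
      supdist K (fst (W s)) (fst (W t)) < e \<and> supdist K (snd (W s)) (snd (W t)) < e"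
    if t: "t \<in> {0..T}" and e: "e > 0" for t e
  proof -
    obtain \<delta> where \<delta>: "\<delta> > 0" "\<And>s. s \<in> {0..T} \<Longrightarrow> \<bar>s - t\<bar> < \<delta> \<Longrightarrow> norm (W s - W t) < e / 2"
      using cont[unfolded continuous_on_iff dist_norm real_norm_def, rule_format, OF t, of "e / 2"] e
      by auto
    have le: "supdist K (fst (W s)) (fst (W t)) \<le> norm (W s - W t)"
      "supdist K (snd (W s)) (snd (W t)) \<le> norm (W s - W t)" for s
      using abs_fst_eval_le[of "W s - W t"] abs_snd_eval_le[of "W s - W t"]
      by (auto intro!: supdist_le)
    have "supdist K (fst (W s)) (fst (W t)) < e \<and> supdist K (snd (W s)) (snd (W t)) < e"
      if "s \<in> {t. 0 \<le> t \<and> ereal t < ereal T}" "\<bar>s - t\<bar> < \<delta>" for s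
    proof -
      have "norm (W s - W t) < e / 2"
        using that by (intro \<delta>(2)) auto
      with le[of s] e show ?thesis by linarith
    qed
    with \<delta>(1) show ?thesis by blast
  qed
  have "inU a b K (fst (W t))" "inU a b K (snd (W t))" if "t \<in> {0..T}" for t
    using range[OF that] box by (force simp: inU_def)+
  then show ?thesis
    unfolding mild_def Let_def using XS eqs cont_sup by auto
qed

text \<open>The equation is known only on \<open>K\<close>. Taken at \<open>retr x\<close>, with
  both sides invariant under \<open>retr\<close>, it holds at every digit sequence, which is
  equality in the Banach space. T < T' because \<open>solves\<close> includes the endpoint.\<close>

lemma solves_of_mild:
  assumes eqn: "mild_equation (semi \<epsilon> d) (nemytskii_pair h k) T C \<Lambda>0"
    and bl: "bounded_lipschitz \<Lambda> B h" "bounded_lipschitz \<Lambda>' B' k"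
    and mild: "mild p N G0 A a b f g \<epsilon> d (continuous_on K) T' u0 v0 u v" and T': "ereal T < T'"
    and u0: "continuous_on K u0" and v0: "continuous_on K v0"
    and range: "\<And>t x. t \<in> {0..T} \<Longrightarrow> x \<in> K \<Longrightarrow> u t x \<in> {\<alpha>..\<beta>} \<and> v t x \<in> {\<alpha>..\<beta>}"
    and agree: "\<And>r s. r \<in> {\<alpha>..\<beta>} \<Longrightarrow> s \<in> {\<alpha>..\<beta>} \<Longrightarrow> h r s = f r s \<and> k r s = g r s"
    and cont: "continuous_on {0..T} (\<lambda>t. (ext (u t), ext (v t)))"
  shows "mild_equation.solves (semi \<epsilon> d) (nemytskii_pair h k) T (ext u0, ext v0) (\<lambda>t. (ext (u t), ext (v t)))"
proof -
  interpret mild_equation "semi \<epsilon> d" "nemytskii_pair h k" T C \<Lambda>0 by fact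
  let ?W = "\<lambda>t. (ext (u t), ext (v t))"
  have I: "0 \<le> t \<and> ereal t < T'" if "t \<in> {0..T}" for t
    using that T' by (auto intro: le_less_trans[of _ "ereal T"])
  have cu: "continuous_on K (u t)" "continuous_on K (v t)" if "t \<in> {0..T}" for t
    using mild I[OF that] unfolding mild_def Let_def by auto
  have eqs: "u t x = expL p N G0 A (\<epsilon> * t) u0 x
            + integral {0..t} (\<lambda>s. expL p N G0 A (\<epsilon> * (t - s)) (\<lambda>y. f (u s y) (v s y)) x)"
     "v t x = expL p N G0 A (\<epsilon> * d * t) v0 x
            + integral {0..t} (\<lambda>s. expL p N G0 A (\<epsilon> * d * (t - s)) (\<lambda>y. g (u s y) (v s y)) x)"
    if "t \<in> {0..T}" "x \<in> K" for t x
    using mild I[OF that(1)] that(2) unfolding mild_def Let_def by auto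
  have nemytskii_retr: "nemytskii h (?W s) (retr x) = nemytskii h (?W s) x" "nemytskii k (?W s) (retr x) = nemytskii k (?W s) x"
    if "s \<in> {0..T}" for s x
    using cu[OF that] by (simp_all add: nemytskii_apply[OF bl(1)] nemytskii_apply[OF bl(2)] ext_retr)
  have "?W t = semi \<epsilon> d t (ext u0, ext v0) + duhamel (\<lambda>s. nemytskii_pair h k (?W s)) t" if t: "t \<in> {0..T}" for t
  proof (rule prod_eqI; rule bcontfun_eqI)
    fix x
    let ?x = "retr x"
    have nl: "f (u s y) (v s y) = nemytskii h (?W s) y" "g (u s y) (v s y) = nemytskii k (?W s) y"
      if "s \<in> {0..t}" "y \<in> K" for s y
      using range[of s y] agree t that cu[of s]
      by (auto simp: nemytskii_apply[OF bl(1)] nemytskii_apply[OF bl(2)] ext_eq)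
    have sub: "s \<in> {0..T}" if "s \<in> {0..t}" for s
      using that t by auto
    have 1: "expL p N G0 A r u0 ?x = Texp r (ext u0) x" "expL p N G0 A r v0 ?x = Texp r (ext v0) x" for r
      using expL_eq[OF retr_in_K ext_eq[symmetric, OF u0]] expL_eq[OF retr_in_K ext_eq[symmetric, OF v0]]
        Texp_retr[OF ext_retr[OF u0]] Texp_retr[OF ext_retr[OF v0]] by simp_all
    have 2: "expL p N G0 A r (\<lambda>y. f (u s y) (v s y)) ?x = Texp r (nemytskii h (?W s)) x"
      "expL p N G0 A r (\<lambda>y. g (u s y) (v s y)) ?x = Texp r (nemytskii k (?W s)) x"
      if s: "s \<in> {0..t}" for r s
      using expL_eq[OF retr_in_K nl(1)[OF s]] expL_eq[OF retr_in_K nl(2)[OF s]]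
        Texp_retr[OF nemytskii_retr(1)[OF sub[OF s]]] Texp_retr[OF nemytskii_retr(2)[OF sub[OF s]]] by simp_all
    have "fst (?W t) x = Texp (\<epsilon> * t) (ext u0) x
        + integral {0..t} (\<lambda>s. expL p N G0 A (\<epsilon> * (t - s)) (\<lambda>y. f (u s y) (v s y)) ?x)"
      using eqs(1)[OF t retr_in_K] by (simp add: ext_apply cu[OF t] 1)
    also have "integral {0..t} (\<lambda>s. expL p N G0 A (\<epsilon> * (t - s)) (\<lambda>y. f (u s y) (v s y)) ?x)
        = integral {0..t} (\<lambda>s. Texp (\<epsilon> * (t - s)) (fst (nemytskii_pair h k (?W s))) x)"
      by (rule integral_cong) (simp add: 2 nemytskii_pair_def)
    finally show "fst (?W t) x = fst (semi \<epsilon> d t (ext u0, ext v0) + duhamel (\<lambda>s. nemytskii_pair h k (?W s)) t) x"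
      unfolding duhamel_eval(1)[OF eqn continuous_F[OF cont] t, symmetric] by (simp add: semi_def)
    have "snd (?W t) x = Texp (\<epsilon> * d * t) (ext v0) x
        + integral {0..t} (\<lambda>s. expL p N G0 A (\<epsilon> * d * (t - s)) (\<lambda>y. g (u s y) (v s y)) ?x)"
      using eqs(2)[OF t retr_in_K] by (simp add: ext_apply cu[OF t] 1)
    also have "integral {0..t} (\<lambda>s. expL p N G0 A (\<epsilon> * d * (t - s)) (\<lambda>y. g (u s y) (v s y)) ?x)
        = integral {0..t} (\<lambda>s. Texp (\<epsilon> * d * (t - s)) (snd (nemytskii_pair h k (?W s))) x)"
      by (rule integral_cong) (simp add: 2 nemytskii_pair_def)
    finally show "snd (?W t) x = snd (semi \<epsilon> d t (ext u0, ext v0) + duhamel (\<lambda>s. nemytskii_pair h k (?W s)) t) x"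
      unfolding duhamel_eval(2)[OF eqn continuous_F[OF cont] t, symmetric] by (simp add: semi_def)
  qed
  then show ?thesis
    using cont by (simp add: solves_def)
qed

section \<open>Continuity and range of a given solution\<close>

lemma continuous_ext_mild:
  assumes mild: "mild p N G0 A a b f g \<epsilon> d (continuous_on K) T' u0 v0 u v" and T': "ereal T < T'"
  shows "continuous_on {0..T} (\<lambda>t. (ext (u t), ext (v t)))"
proof -
  have I: "0 \<le> t \<and> ereal t < T'" if "t \<in> {0..T}" for t
    using that T' by (auto intro: le_less_trans[of _ "ereal T"])
  have cu: "continuous_on K (u t)" "continuous_on K (v t)" if "t \<in> {0..T}" for t
    using mild I[OF that] unfolding mild_def Let_def by auto
  have cont: "\<exists>\<delta>>0. \<forall>s\<in>{0..T}. \<bar>s - t\<bar> < \<delta> \<longrightarrow>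
      norm (ext (u s) - ext (u t)) < e \<and> norm (ext (v s) - ext (v t)) < e"
    if t: "t \<in> {0..T}" and e: "e > 0" for t e
  proof -
    obtain \<delta> where "\<delta> > 0" and \<delta>: "\<And>s. s \<in> {0..T} \<Longrightarrow> \<bar>s - t\<bar> < \<delta> \<Longrightarrow>
        supdist K (u s) (u t) < e \<and> supdist K (v s) (v t) < e"
      using mild I[OF t] I e unfolding mild_def Let_def by (metis (mono_tags, lifting) mem_Collect_eq)
    then show ?thesis
      using norm_ext_diff_le_supdist cu t by (meson le_less_trans)
  qed
  show ?thesis
    by (intro continuous_on_Pair; unfold continuous_on_iff dist_norm real_norm_def; use cont in meson)
qed

text \<open>The trajectory is jointly continuous on the compact set [0,T] x K, so its extreme values
  are attained, and attained values lie in the open interval (a,b).\<close>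

lemma mild_range:
  assumes mild: "mild p N G0 A a b f g \<epsilon> d (continuous_on K) T' u0 v0 u v"
    and T': "ereal T < T'" and T: "0 \<le> T"
  obtains \<alpha> \<beta> where "a < \<alpha>" "\<alpha> \<le> \<beta>" "\<beta> < b"
    "\<And>t x. t \<in> {0..T} \<Longrightarrow> x \<in> K \<Longrightarrow> u t x \<in> {\<alpha>..\<beta>} \<and> v t x \<in> {\<alpha>..\<beta>}"
proof -
  have I: "0 \<le> t \<and> ereal t < T'" if "t \<in> {0..T}" for t
    using that T' by (auto intro: le_less_trans[of _ "ereal T"])
  have cu: "continuous_on K (u t)" "continuous_on K (v t)"
    and U: "x \<in> K \<Longrightarrow> a < u t x \<and> u t x < b \<and> a < v t x \<and> v t x < b" if "t \<in> {0..T}" for t x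
    using mild I[OF that] unfolding mild_def Let_def inU_def by auto
  let ?D = "{0..T} \<times> K"
  have cont: "continuous_on {0..T} (\<lambda>t. ext (u t))" "continuous_on {0..T} (\<lambda>t. ext (v t))"
    using continuous_on_fst[OF continuous_ext_mild[OF mild T']]
      continuous_on_snd[OF continuous_ext_mild[OF mild T']] by simp_all
  have *: "continuous_on ?D (\<lambda>z. u (fst z) (snd z))" "continuous_on ?D (\<lambda>z. v (fst z) (snd z))"
    by (rule continuous_on_eq[OF continuous_bcontfun_eval[OF cont(1)]], use cu in \<open>force simp: ext_eq\<close>)
       (rule continuous_on_eq[OF continuous_bcontfun_eval[OF cont(2)]], use cu in \<open>force simp: ext_eq\<close>)
  have D: "compact ?D" "?D \<noteq> {}"
    using compact_K K_ne T by (auto intro: compact_Times)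
  have cm: "continuous_on ?D (\<lambda>z. min (u (fst z) (snd z)) (v (fst z) (snd z)))"
    "continuous_on ?D (\<lambda>z. max (u (fst z) (snd z)) (v (fst z) (snd z)))"
    using * by (auto intro: continuous_on_min continuous_on_max)
  obtain z where z: "z \<in> ?D" "\<And>y. y \<in> ?D \<Longrightarrow>
      min (u (fst z) (snd z)) (v (fst z) (snd z)) \<le> min (u (fst y) (snd y)) (v (fst y) (snd y))"
    using continuous_attains_inf[OF D cm(1)] by blast
  obtain z' where z': "z' \<in> ?D" "\<And>y. y \<in> ?D \<Longrightarrow>
      max (u (fst y) (snd y)) (v (fst y) (snd y)) \<le> max (u (fst z') (snd z')) (v (fst z') (snd z'))"
    using continuous_attains_sup[OF D cm(2)] by blast
  show ?thesis
  proof (rule that)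
    show "a < min (u (fst z) (snd z)) (v (fst z) (snd z))"
      using U[of "fst z" "snd z"] z(1) by auto
    show "max (u (fst z') (snd z')) (v (fst z') (snd z')) < b"
      using U[of "fst z'" "snd z'"] z'(1) by auto
    show "min (u (fst z) (snd z)) (v (fst z) (snd z)) \<le> max (u (fst z') (snd z')) (v (fst z') (snd z'))"
      using z(2)[OF z(1)] z'(2)[OF z(1)] by linarith
    show "u t x \<in> {min (u (fst z) (snd z)) (v (fst z) (snd z))..max (u (fst z') (snd z')) (v (fst z') (snd z'))}
       \<and> v t x \<in> {min (u (fst z) (snd z)) (v (fst z) (snd z))..max (u (fst z') (snd z')) (v (fst z') (snd z'))}"
      if "t \<in> {0..T}" "x \<in> K" for t x
      using z(2)[of "(t, x)"] z'(2)[of "(t, x)"] that by auto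
  qed
qed

section \<open>Locally constant functions\<close>

text \<open>X_M without reference to representatives: constancy on the part of each ball of radius
  p^(-M) inside \<open>K\<close>, with no condition elsewhere.\<close>

definition digit_fun :: "nat \<Rightarrow> ((nat \<Rightarrow> nat) \<Rightarrow> real) \<Rightarrow> bool" where
  "digit_fun M \<phi> \<longleftrightarrow> (\<forall>x\<in>K. \<forall>y\<in>K. (\<forall>i<M. x i = y i) \<longrightarrow> \<phi> x = \<phi> y)"

lemma mild_solution_digits:
  fixes W0 :: "bcf \<times> bcf"
  assumes eqn: "mild_equation (semi \<epsilon> d) (nemytskii_pair h k) T C \<Lambda>0"
    and bl: "bounded_lipschitz \<Lambda> B h" "bounded_lipschitz \<Lambda>' B' k"
    and "N \<le> M" "digit_fun M (fst W0)" "digit_fun M (snd W0)"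
  obtains W where "mild_equation.solves (semi \<epsilon> d) (nemytskii_pair h k) T W0 W"
    "\<And>t. t \<in> {0..T} \<Longrightarrow> digit_fun M (fst (W t)) \<and> digit_fun M (snd (W t))"
proof -
  interpret mild_equation "semi \<epsilon> d" "nemytskii_pair h k" T C \<Lambda>0 by fact
  define P where "P = {(x, y). x \<in> K \<and> y \<in> K \<and> (\<forall>i<M. x i = y i)}"
  \<comment> \<open>Differences of evaluations at points that share M digits, for each component:
    their common kernel is X_M x X_M in the form that \<open>solves_exists\<close> asks for.\<close>
  define Q where "Q = (\<lambda>(x, y) W :: bcf \<times> bcf. apply_bcontfun (fst W) x - apply_bcontfun (fst W) y) ` P
      \<union> (\<lambda>(x, y) W. apply_bcontfun (snd W) x - apply_bcontfun (snd W) y) ` P"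
  define V where "V = {W :: bcf \<times> bcf. \<forall>l\<in>Q. l W = 0}"
  have V: "W \<in> V \<longleftrightarrow> digit_fun M (fst W) \<and> digit_fun M (snd W)" for W
    unfolding V_def Q_def mem_Collect_eq ball_Un ball_simps by (auto simp: P_def digit_fun_def)
  have ev: "bounded_linear (\<lambda>W :: bcf \<times> bcf. apply_bcontfun (fst W) x)"
    "bounded_linear (\<lambda>W :: bcf \<times> bcf. apply_bcontfun (snd W) x)" for x
    by (rule bounded_linear_compose[OF bounded_linear_eval] bounded_linear_fst bounded_linear_snd)+
  have Q: "bounded_linear l" if "l \<in> Q" for l
    using that by (auto simp: Q_def intro!: bounded_linear_sub ev)
  have S_V: "semi \<epsilon> d t W \<in> V" if "W \<in> V" for t W
    using that unfolding V semi_def digit_fun_def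
    by (auto intro!: Texp_digits[OF \<open>N \<le> M\<close>])
  have F_V: "nemytskii_pair h k W \<in> V" if "W \<in> V" for W
  proof -
    have eq: "apply_bcontfun (fst W) x = apply_bcontfun (fst W) y"
      "apply_bcontfun (snd W) x = apply_bcontfun (snd W) y"
      if "x \<in> K" "y \<in> K" "\<forall>i<M. x i = y i" for x y
      using \<open>W \<in> V\<close> that unfolding V digit_fun_def by blast+
    have "digit_fun M (nemytskii h W)" "digit_fun M (nemytskii k W)"
      unfolding digit_fun_def nemytskii_apply[OF bl(1)] nemytskii_apply[OF bl(2)]
      by (intro ballI impI; simp only: eq)+
    then show ?thesis
      by (simp add: V nemytskii_pair_def)
  qed
  have "W0 \<in> V"
    using assms by (simp add: V)
  from solves_exists[OF Q this V_def S_V F_V] show ?thesis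
    using that unfolding V by blast
qed

section \<open>Coset representatives and the projections P_M\<close>

definition representatives :: "nat \<Rightarrow> (nat \<Rightarrow> nat) set \<Rightarrow> bool" where
  "representatives M R \<longleftrightarrow> R \<subseteq> K \<and> (\<forall>x\<in>K. \<exists>!r. r \<in> R \<and> (\<forall>i<M. x i = r i))"

text \<open>A representative is determined by its first M digits, which take finitely many values.
  Finiteness matters because a sum over an infinite set is 0 by convention.\<close>

lemma finite_representatives:
  assumes "representatives M R"
  shows "finite R"
proof (rule inj_on_finite)
  show "inj_on (\<lambda>r. restrict r {..<M}) R"
  proof (rule inj_onI)
    fix r s assume rs: "r \<in> R" "s \<in> R" and eq: "restrict r {..<M} = restrict s {..<M}"
    have "r i = s i" if "i < M" for i
      using fun_cong[OF eq, of i] that by simp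
    moreover have "r \<in> K"
      using assms rs(1) by (auto simp: representatives_def)
    then have "\<exists>!t. t \<in> R \<and> (\<forall>i<M. r i = t i)"
      using assms by (simp add: representatives_def)
    ultimately show "r = s"
      using rs by blast
  qed
  show "(\<lambda>r. restrict r {..<M}) ` R \<subseteq> PiE {..<M} (\<lambda>_. {..<p})"
  proof
    fix y assume "y \<in> (\<lambda>r. restrict r {..<M}) ` R"
    then obtain r where r: "r \<in> R" "y = restrict r {..<M}" by blast
    then have "r \<in> K"
      using assms by (auto simp: representatives_def)
    then show "y \<in> PiE {..<M} (\<lambda>_. {..<p})"
      by (simp add: r(2) KN_def Zp_def)
  qed
  show "finite (PiE {..<M} (\<lambda>_. {..<p}))"
    by (intro finite_PiE) auto
qed

text \<open>Exactly one ball centred in R contains x, so one summand of \<open>PM\<close> survives;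
  its centre r is the same for every \<phi>.\<close>

lemma PM_eq:
  assumes "representatives M R" "x \<in> K"
  obtains r where "r \<in> K" "\<forall>i<M. x i = r i" "\<And>\<phi>. PM R M \<phi> x = \<phi> r"
proof -
  from assms have ex: "\<exists>!r. r \<in> R \<and> (\<forall>i<M. x i = r i)"
    by (simp add: representatives_def)
  then obtain r where r: "r \<in> R" "\<forall>i<M. x i = r i" by blast
  have Om: "Omega M s x = (if s = r then 1 else 0)" if "s \<in> R" for s
    using ex r that by (auto simp: Omega_def)
  have "PM R M \<phi> x = \<phi> r" for \<phi>
  proof -
    have "PM R M \<phi> x = (\<Sum>s\<in>R. if s = r then \<phi> s else 0)"
      unfolding PM_def by (rule sum.cong) (simp_all add: Om)
    also have "\<dots> = \<phi> r"
      using finite_representatives[OF assms(1)] r(1) by simp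
    finally show ?thesis .
  qed
  with r assms(1) show ?thesis
    by (intro that[of r]) (auto simp: representatives_def)
qed

text \<open>A function of the first M digits equals its own projection, so its values at the
  representatives serve as coefficients.\<close>

lemma XM_of_digit_fun:
  assumes "representatives M R" "digit_fun M \<phi>"
  shows "XM p N G0 R M \<phi>"
proof -
  have "\<phi> x = PM R M \<phi> x" if "x \<in> K" for x
    using PM_eq[OF assms(1) that] assms(2) that unfolding digit_fun_def by metis
  then show ?thesis
    unfolding XM_def PM_def by blast
qed

lemma PM_digits: "(\<forall>i<M. x i = y i) \<Longrightarrow> PM R M \<phi> x = PM R M \<phi> y"
  by (simp add: PM_def Omega_digits[of M x y])

lemma continuous_PM: "continuous_on S (PM R M \<phi>)"
  by (rule continuous_on_digits) (rule PM_digits)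

lemma digit_fun_ext_PM: "digit_fun M (ext (PM R M \<phi>))"
  unfolding digit_fun_def using PM_digits by (simp add: ext_eq continuous_PM)

text \<open>At x the projection takes the value of \<phi> at a representative that shares M digits
  with x, so uniform continuity in digits bounds the error for all x at once.\<close>

lemma ext_PM_tendsto:
  assumes R: "\<And>M. N \<le> M \<Longrightarrow> representatives M (R M)" and \<phi>: "continuous_on K \<phi>"
  shows "(\<lambda>M. ext (PM (R M) M \<phi>)) \<longlonglongrightarrow> ext \<phi>"
proof (rule LIMSEQ_I)
  fix e :: real assume "e > 0"
  \<comment> \<open>Half of e, since passing to the sup norm turns the strict bound into a weak
    one.\<close>
  obtain m where m: "\<And>x y. x \<in> K \<Longrightarrow> y \<in> K \<Longrightarrow> (\<forall>i<m. x i = y i) \<Longrightarrow> \<bar>\<phi> x - \<phi> y\<bar> < e / 2"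
    using continuous_on_compact_digits[OF compact_K \<phi>, of "e / 2"] \<open>e > 0\<close> by auto
  have "norm (ext (PM (R M) M \<phi>) - ext \<phi>) < e" if M: "max m N \<le> M" for M
  proof -
    have "norm (ext (PM (R M) M \<phi>) - ext \<phi>) \<le> e / 2"
    proof (rule norm_ext_diff_le[OF continuous_PM \<phi>])
      fix x assume x: "x \<in> K"
      obtain r where r: "r \<in> K" "\<forall>i<M. x i = r i" "PM (R M) M \<phi> x = \<phi> r"
        using PM_eq[OF R x] M by (metis max.bounded_iff)
      then have "\<bar>\<phi> x - \<phi> r\<bar> < e / 2"
        using M x by (intro m) auto
      with r(3) show "\<bar>PM (R M) M \<phi> x - \<phi> x\<bar> \<le> e / 2" by linarith
    qed
    with \<open>e > 0\<close> show ?thesis by simp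
  qed
  then show "\<exists>M0. \<forall>M\<ge>M0. norm (ext (PM (R M) M \<phi>) - ext \<phi>) < e"
    by blast
qed

end

section \<open>Convergence of the discretised system\<close>

theorem theorem3:
  fixes p N :: nat and G0 :: "(nat \<Rightarrow> nat) set"
    and A :: "(nat \<Rightarrow> nat) \<Rightarrow> (nat \<Rightarrow> nat) \<Rightarrow> real"
    and GM :: "nat \<Rightarrow> (nat \<Rightarrow> nat) set"
    and a b \<epsilon> d \<tau> :: real and f g :: "real \<Rightarrow> real \<Rightarrow> real"
    and u0 v0 :: "(nat \<Rightarrow> nat) \<Rightarrow> real" and u v :: "real \<Rightarrow> (nat \<Rightarrow> nat) \<Rightarrow> real"
  assumes "prime p" and "N \<ge> 1"
    and "finite G0" and "G0 \<noteq> {}" and "G0 \<subseteq> Zp p" and "\<forall>I\<in>G0. \<forall>i\<ge>N. I i = 0"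
    and "\<forall>J\<in>G0. \<forall>K\<in>G0. A J K \<in> {0, 1}"
    and "\<forall>M\<ge>N. GM M \<subseteq> KN p N G0 \<and> (\<forall>x\<in>KN p N G0. \<exists>!R. R \<in> GM M \<and> (\<forall>i<M. x i = R i))"
    and "a < b" and "C1_grad a b f" and "C1_grad a b g"
    and "\<epsilon> > 0" and "d > 0"
    and "continuous_on (KN p N G0) u0" and "inU a b (KN p N G0) u0"
    and "continuous_on (KN p N G0) v0" and "inU a b (KN p N G0) v0"
    and "mild p N G0 A a b f g \<epsilon> d (continuous_on (KN p N G0))
           (tmax p N G0 A a b f g \<epsilon> d (continuous_on (KN p N G0)) u0 v0) u0 v0 u v"
    and "0 < \<tau>" and "ereal \<tau> < tmax p N G0 A a b f g \<epsilon> d (continuous_on (KN p N G0)) u0 v0"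
  shows "\<exists>M0\<ge>N. \<exists>uM vM :: nat \<Rightarrow> real \<Rightarrow> (nat \<Rightarrow> nat) \<Rightarrow> real.
    (\<forall>M\<ge>M0. \<exists>T > ereal \<tau>. mild p N G0 A a b f g \<epsilon> d (XM p N G0 (GM M) M) T
        (PM (GM M) M u0) (PM (GM M) M v0) (uM M) (vM M)) \<and>
    (\<lambda>M. SUP t\<in>{0..\<tau>}. max (supdist (KN p N G0) (uM M t) (u t))
                              (supdist (KN p N G0) (vM M t) (v t))) \<longlonglongrightarrow> 0"
proof -
  interpret network p N G0 A
    using assms(1,3-5) by unfold_locales (auto simp: prime_gt_0_nat)
  have R: "representatives M (GM M)" if "N \<le> M" for M
    using assms(8) that by (simp add: representatives_def)
  note u0 = \<open>continuous_on K u0\<close> and v0 = \<open>continuous_on K v0\<close> and mild = assms(18)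
  let ?T' = "tmax p N G0 A a b f g \<epsilon> d (continuous_on K) u0 v0"
  \<comment> \<open>The maximal time may be infinite; a real T below it gives a compact [0,T], and T
    > \<tau> makes the half-open [0,T) contain [0,\<tau>].\<close>
  obtain T where T: "\<tau> < T" "ereal T < ?T'"
    using ereal_dense2[OF assms(20)] by (metis ereal_less_eq(3) less_ereal.simps(1) not_le)
  with \<open>0 < \<tau>\<close> have T_nonneg: "0 \<le> T" by simp
  obtain \<alpha>0 \<beta>0 where \<alpha>\<beta>0: "a < \<alpha>0" "\<alpha>0 \<le> \<beta>0" "\<beta>0 < b"
    and range0: "\<And>t x. t \<in> {0..T} \<Longrightarrow> x \<in> K \<Longrightarrow> u t x \<in> {\<alpha>0..\<beta>0} \<and> v t x \<in> {\<alpha>0..\<beta>0}"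
    using mild_range[OF mild T(2) T_nonneg] by blast
  \<comment> \<open>Half the smaller gap to the ends of (a,b): the box enlarged by \<eta> still lies
    inside, and the given solution keeps distance at least \<eta> from its edges.\<close>
  define \<eta> where "\<eta> = min (\<alpha>0 - a) (b - \<beta>0) / 2"
  define \<alpha> \<beta> where "\<alpha> = \<alpha>0 - \<eta>" and "\<beta> = \<beta>0 + \<eta>"
  have \<eta>: "0 < \<eta>" "\<eta> < \<alpha>0 - a" "\<eta> < b - \<beta>0"
    using \<alpha>\<beta>0 by (auto simp: \<eta>_def min_def)
  then have \<alpha>\<beta>: "a < \<alpha>" "\<alpha> \<le> \<beta>" "\<beta> < b"
    using \<alpha>\<beta>0 by (auto simp: \<alpha>_def \<beta>_def)
  have range: "u t x \<in> {\<alpha>..\<beta>} \<and> v t x \<in> {\<alpha>..\<beta>}" if "t \<in> {0..T}" "x \<in> K" for t x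
    using range0[OF that] \<eta> by (auto simp: \<alpha>_def \<beta>_def)
  let ?h = "clip \<alpha> \<beta> f" and ?k = "clip \<alpha> \<beta> g"
  obtain \<Lambda> B where h: "bounded_lipschitz \<Lambda> B ?h"
    using C1_bounded_lipschitz_clip[OF \<open>C1_grad a b f\<close> \<alpha>\<beta>] .
  obtain \<Lambda>' B' where k: "bounded_lipschitz \<Lambda>' B' ?k"
    using C1_bounded_lipschitz_clip[OF \<open>C1_grad a b g\<close> \<alpha>\<beta>] .
  have agree: "?h r s = f r s \<and> ?k r s = g r s" if "r \<in> {\<alpha>..\<beta>}" "s \<in> {\<alpha>..\<beta>}" for r s
    using that by (simp add: clip_eq)
  obtain C where eqn: "mild_equation (semi \<epsilon> d) (nemytskii_pair ?h ?k) T C (2 * \<Lambda> + 2 * \<Lambda>')"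
    using mild_equation_semi[OF \<open>\<epsilon> > 0\<close> \<open>d > 0\<close> T_nonneg h k] .
  interpret mild_equation "semi \<epsilon> d" "nemytskii_pair ?h ?k" T C "2 * \<Lambda> + 2 * \<Lambda>'"
    by (rule eqn)
  define W where "W t = (ext (u t), ext (v t))" for t
  define W0 where "W0 = (ext u0, ext v0)"
  define W0' where "W0' M = (ext (PM (GM M) M u0), ext (PM (GM M) M v0))" for M
  have sol: "solves W0 W"
    unfolding W_def W0_def
    by (rule solves_of_mild[OF eqn h k mild T(2) u0 v0 range agree continuous_ext_mild[OF mild T(2)]])
  have "\<exists>W'. solves (W0' M) W' \<and>
      (\<forall>t\<in>{0..T}. digit_fun M (fst (W' t)) \<and> digit_fun M (snd (W' t)))" if "N \<le> M" for M
  proof -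
    have "digit_fun M (fst (W0' M))" "digit_fun M (snd (W0' M))"
      by (simp_all add: W0'_def digit_fun_ext_PM)
    from mild_solution_digits[OF eqn h k that this] obtain W' where "solves (W0' M) W'"
      "\<And>t. t \<in> {0..T} \<Longrightarrow> digit_fun M (fst (W' t)) \<and> digit_fun M (snd (W' t))"
      by blast
    then show ?thesis
      by (intro exI[of _ W'] conjI ballI) blast+
  qed
  then obtain W' where sol': "\<And>M. N \<le> M \<Longrightarrow> solves (W0' M) (W' M)"
    and digits: "\<And>M t. N \<le> M \<Longrightarrow> t \<in> {0..T} \<Longrightarrow>
        digit_fun M (fst (W' M t)) \<and> digit_fun M (snd (W' M t))"
    by metis
  define \<delta> where "\<delta> M = 2 * C * exp (growth * T) * norm (W0' M - W0)" for M
  have close: "norm (W' M t - W t) \<le> \<delta> M" if "N \<le> M" "t \<in> {0..T}" for M t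
    using solves_dependence[OF sol'[OF that(1)] sol that(2)] by (simp add: \<delta>_def)
  have "W0' \<longlonglongrightarrow> W0"
    unfolding W0'_def W0_def by (intro tendsto_Pair ext_PM_tendsto R u0 v0)
  then have "(\<lambda>M. norm (W0' M - W0)) \<longlonglongrightarrow> 0"
    by (simp add: LIM_zero_iff tendsto_norm_zero)
  then have \<delta>: "\<delta> \<longlonglongrightarrow> 0"
    unfolding \<delta>_def using tendsto_mult_right_zero by blast
  then have "\<forall>\<^sub>F M in sequentially. \<delta> M < \<eta>"
    using \<eta>(1) by (simp add: order_tendstoD(2))
  then obtain M1 where M1: "\<And>M. M1 \<le> M \<Longrightarrow> \<delta> M < \<eta>"
    by (auto simp: eventually_sequentially)
  \<comment> \<open>Beyond \<open>M0\<close> the error is below the margin \<eta>, so the truncated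
    approximations do not leave the box on [0,T].\<close>
  define M0 where "M0 = max N M1"
  have I: "ereal t < ?T'" if "t \<in> {0..T}" for t
    using that T(2) by (auto intro: le_less_trans[of _ "ereal T"])
  have cu: "continuous_on K (u t)" "continuous_on K (v t)" if "t \<in> {0..T}" for t
    using mild I[OF that] that unfolding mild_def Let_def by auto
  have diff: "\<bar>fst (W' M t) x - u t x\<bar> \<le> \<delta> M" "\<bar>snd (W' M t) x - v t x\<bar> \<le> \<delta> M"
    if "N \<le> M" "t \<in> {0..T}" "x \<in> K" for M t x
  proof -
    have "norm (fst (W' M t - W t) x) \<le> \<delta> M" "norm (snd (W' M t - W t) x) \<le> \<delta> M"
      using close[OF that(1,2)] abs_fst_eval_le[of "W' M t - W t" x]
        abs_snd_eval_le[of "W' M t - W t" x] by simp_all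
    then show "\<bar>fst (W' M t) x - u t x\<bar> \<le> \<delta> M" "\<bar>snd (W' M t) x - v t x\<bar> \<le> \<delta> M"
      using that cu by (simp_all add: W_def ext_eq)
  qed
  have mild': "mild p N G0 A a b f g \<epsilon> d (XM p N G0 (GM M) M) (ereal T)
        (PM (GM M) M u0) (PM (GM M) M v0) (\<lambda>t. fst (W' M t)) (\<lambda>t. snd (W' M t))" if "M0 \<le> M" for M
  proof (rule mild_of_solves[OF eqn h k sol' _ _ _ _ \<alpha>\<beta>(1,3) agree])
    show M: "N \<le> M" using that by (simp add: M0_def)
    show "PM (GM M) M u0 x = fst (W0' M) x" "PM (GM M) M v0 x = snd (W0' M) x" if "x \<in> K" for x
      using that by (simp_all add: W0'_def ext_eq continuous_PM)
    show "XM p N G0 (GM M) M (fst (W' M t)) \<and> XM p N G0 (GM M) M (snd (W' M t))" if "t \<in> {0..T}" for t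
      using digits[OF M that] R[OF M] by (simp add: XM_of_digit_fun)
    show "fst (W' M t) x \<in> {\<alpha>..\<beta>} \<and> snd (W' M t) x \<in> {\<alpha>..\<beta>}" if "t \<in> {0..T}" "x \<in> K" for t x
      using diff[OF M that] M1[of M] range0[OF that] \<open>M0 \<le> M\<close>
      by (auto simp: M0_def \<alpha>_def \<beta>_def abs_le_iff)
  qed auto
  have "(\<lambda>M. SUP t\<in>{0..\<tau>}. max (supdist K (fst (W' M t)) (u t)) (supdist K (snd (W' M t)) (v t)))
      \<longlonglongrightarrow> 0"
  proof (rule tendsto_sandwich[OF _ _ tendsto_const \<delta>])
    have le: "max (supdist K (fst (W' M t)) (u t)) (supdist K (snd (W' M t)) (v t)) \<le> \<delta> M"
      if "N \<le> M" "t \<in> {0..\<tau>}" for M t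
      using diff[OF that(1), of t] that T(1) by (auto intro!: supdist_le)
    show "\<forall>\<^sub>F M in sequentially. (SUP t\<in>{0..\<tau>}. max (supdist K (fst (W' M t)) (u t))
        (supdist K (snd (W' M t)) (v t))) \<le> \<delta> M"
      using eventually_ge_at_top[of N]
    proof (rule eventually_mono)
      fix M assume "N \<le> M"
      with le \<open>0 < \<tau>\<close> show "(SUP t\<in>{0..\<tau>}. max (supdist K (fst (W' M t)) (u t))
        (supdist K (snd (W' M t)) (v t))) \<le> \<delta> M"
        by (intro cSUP_least) auto
    qed
    \<comment> \<open>The lower bound needs a \<open>SUP\<close> bounded above, which \<delta> M
      provides, and one nonnegative member: at t = 0 \<open>supdist\<close> dominates a
      norm.\<close>
    have "0 \<le> (SUP t\<in>{0..\<tau>}. max (supdist K (fst (W' M t)) (u t)) (supdist K (snd (W' M t)) (v t)))"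
      if M: "N \<le> M" for M
    proof (rule cSUP_upper2[where x = 0])
      show "bdd_above ((\<lambda>t. max (supdist K (fst (W' M t)) (u t)) (supdist K (snd (W' M t)) (v t))) ` {0..\<tau>})"
        by (rule bdd_aboveI2[where M = "\<delta> M"]) (rule le[OF M])
      have "0 \<le> norm (ext (fst (W' M 0)) - ext (u 0))" by simp
      also have "\<dots> \<le> supdist K (fst (W' M 0)) (u 0)"
        using T_nonneg by (intro norm_ext_diff_le_supdist cu) auto
      finally show "0 \<le> max (supdist K (fst (W' M 0)) (u 0)) (supdist K (snd (W' M 0)) (v 0))"
        by simp
    qed (use \<open>0 < \<tau>\<close> in auto)
    then show "\<forall>\<^sub>F M in sequentially. 0 \<le> (SUP t\<in>{0..\<tau>}. max (supdist K (fst (W' M t)) (u t))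
        (supdist K (snd (W' M t)) (v t)))"
      by (rule eventually_mono[OF eventually_ge_at_top[of N]])
  qed
  moreover have "\<exists>T > ereal \<tau>. mild p N G0 A a b f g \<epsilon> d (XM p N G0 (GM M) M) T
        (PM (GM M) M u0) (PM (GM M) M v0) (\<lambda>t. fst (W' M t)) (\<lambda>t. snd (W' M t))" if "M0 \<le> M" for M
    using mild'[OF that] T(1) by (intro exI[of _ "ereal T"]) simp
  moreover have "N \<le> M0"
    by (simp add: M0_def)
  ultimately show ?thesis
    by (intro exI[of _ M0] conjI exI[of _ "\<lambda>M t. apply_bcontfun (fst (W' M t))"]
          exI[of _ "\<lambda>M t. apply_bcontfun (snd (W' M t))"] allI impI)
qed

end
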